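(* Let $P$ be an $r$-differential poset and $Q$ an $s$-differential poset, with rank sizes $p_n$ and $q_n$ respectively. Suppose that $\Delta q_n\ge\Delta q_{n-1}$ for all $n\ge2$, and that all the down maps of at least one of $P$, $Q$ are surjective (over $\mathbb{Z}$). Then for the Cartesian product poset $P\times Q$ and every $n\ge0$, the matrix $[DU_n]+xI$ (where $DU_n$ is computed in $P\times Q$ and $I$ is the identity of size equal to the $n$-th rank size of $P\times Q$) has Smith normal form over $\mathbb{Z}[x]$.
   Context: For a positive integer $r$, a poset $P$ is $r$-differential if: (D1) $P$ is graded, locally finite, has all rank sizes finite and a unique minimum element; (D2) if two distinct elements of $P$ both cover exactly $k$ common elements, then exactly $k$ elements cover them both; (D3) if an element covers $k$ elements then it is covered by exactly $k+r$ elements. $P_n$ is the $n$-th rank (empty for $n<0$), $p_n=|P_n|$, $\Delta p_n=p_n-p_{n-1}$. $\mathbb{Z}P_n$ is the free $\mathbb{Z}$-module with basis $P_n$; $U_n:\mathbb{Z}P_n\to\mathbb{Z}P_{n+1}$ sends an element to the sum of all elements covering it, $D_n:\mathbb{Z}P_n\to\mathbb{Z}P_{n-1}$ sends an element to the sum of all elements it covers, $DU_n=D_{n+1}U_n$, and $[DU_n]$ is its matrix in the standard basis. $P\times Q$ is the product poset with componentwise order (it is $(r+s)$-differential). A matrix over a commutative ring $R$ has Smith normal form over $R$ if it can be multiplied on both sides by invertible matrices over $R$ to obtain a diagonal matrix whose diagonal entries satisfy $s_1\mid s_2\mid\cdots$. *)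

theory Defs
  imports "Jordan_Normal_Form.Matrix" "HOL-Computational_Algebra.Polynomial"
begin

definition partial_order_on' :: "'a set \<Rightarrow> ('a \<Rightarrow> 'a \<Rightarrow> bool) \<Rightarrow> bool" where
  "partial_order_on' S leq \<longleftrightarrow>
     (\<forall>x\<in>S. leq x x) \<and>
     (\<forall>x\<in>S. \<forall>y\<in>S. leq x y \<and> leq y x \<longrightarrow> x = y) \<and>
     (\<forall>x\<in>S. \<forall>y\<in>S. \<forall>z\<in>S. leq x y \<and> leq y z \<longrightarrow> leq x z)"

definition covby :: "'a set \<Rightarrow> ('a \<Rightarrow> 'a \<Rightarrow> bool) \<Rightarrow> 'a \<Rightarrow> 'a \<Rightarrow> bool" where
  "covby S leq x y \<longleftrightarrow> x \<in> S \<and> y \<in> S \<and> leq x y \<and> x \<noteq> y \<and>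
     (\<forall>z\<in>S. leq x z \<and> leq z y \<longrightarrow> z = x \<or> z = y)"

definition locally_finite :: "'a set \<Rightarrow> ('a \<Rightarrow> 'a \<Rightarrow> bool) \<Rightarrow> bool" where
  "locally_finite S leq \<longleftrightarrow> (\<forall>x\<in>S. \<forall>y\<in>S. finite {z\<in>S. leq x z \<and> leq z y})"

definition has_unique_min :: "'a set \<Rightarrow> ('a \<Rightarrow> 'a \<Rightarrow> bool) \<Rightarrow> bool" where
  "has_unique_min S leq \<longleftrightarrow> (\<exists>m\<in>S. \<forall>x\<in>S. leq m x)"

definition is_rank_fun :: "'a set \<Rightarrow> ('a \<Rightarrow> 'a \<Rightarrow> bool) \<Rightarrow> ('a \<Rightarrow> nat) \<Rightarrow> bool" where
  "is_rank_fun S leq rk \<longleftrightarrow>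
     (\<forall>x\<in>S. (\<forall>y\<in>S. leq y x \<longrightarrow> y = x) \<longrightarrow> rk x = 0) \<and>
     (\<forall>x y. covby S leq x y \<longrightarrow> rk y = rk x + 1)"

definition graded :: "'a set \<Rightarrow> ('a \<Rightarrow> 'a \<Rightarrow> bool) \<Rightarrow> bool" where
  "graded S leq \<longleftrightarrow> (\<exists>rk. is_rank_fun S leq rk)"

definition rank_of :: "'a set \<Rightarrow> ('a \<Rightarrow> 'a \<Rightarrow> bool) \<Rightarrow> 'a \<Rightarrow> nat" where
  "rank_of S leq = (SOME rk. is_rank_fun S leq rk)"

definition rank_set :: "'a set \<Rightarrow> ('a \<Rightarrow> 'a \<Rightarrow> bool) \<Rightarrow> nat \<Rightarrow> 'a set" where
  "rank_set S leq n = {x\<in>S. rank_of S leq x = n}"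

definition rank_size :: "'a set \<Rightarrow> ('a \<Rightarrow> 'a \<Rightarrow> bool) \<Rightarrow> nat \<Rightarrow> nat" where
  "rank_size S leq n = card (rank_set S leq n)"

definition differential :: "'a set \<Rightarrow> ('a \<Rightarrow> 'a \<Rightarrow> bool) \<Rightarrow> nat \<Rightarrow> bool" where
  "differential S leq r \<longleftrightarrow>
     r > 0 \<and>
     partial_order_on' S leq \<and>
     \<comment> \<open>(D1)\<close>
     graded S leq \<and> locally_finite S leq \<and> (\<forall>n. finite (rank_set S leq n)) \<and> has_unique_min S leq \<and>
     \<comment> \<open>(D2)\<close>
     (\<forall>x\<in>S. \<forall>y\<in>S. x \<noteq> y \<longrightarrow>
        card {z\<in>S. covby S leq z x \<and> covby S leq z y} = card {z\<in>S. covby S leq x z \<and> covby S leq y z}) \<and>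
     \<comment> \<open>(D3)\<close>
     (\<forall>x\<in>S. card {z\<in>S. covby S leq x z} = card {z\<in>S. covby S leq z x} + r)"

definition prod_le :: "('a \<Rightarrow> 'a \<Rightarrow> bool) \<Rightarrow> ('b \<Rightarrow> 'b \<Rightarrow> bool) \<Rightarrow> ('a \<times> 'b) \<Rightarrow> ('a \<times> 'b) \<Rightarrow> bool" where
  "prod_le le1 le2 p q \<longleftrightarrow> le1 (fst p) (fst q) \<and> le2 (snd p) (snd q)"

text \<open>All down maps D_n : Z P_n \<rightarrow> Z P_{n-1} are surjective (n \<ge> 1; for n = 0 the target is 0).
  Elements of Z P_n are represented by their coefficient functions on P_n.\<close>
definition down_maps_surjective :: "'a set \<Rightarrow> ('a \<Rightarrow> 'a \<Rightarrow> bool) \<Rightarrow> bool" where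
  "down_maps_surjective S leq \<longleftrightarrow>
     (\<forall>n\<ge>1. \<forall>g :: 'a \<Rightarrow> int. \<exists>f :: 'a \<Rightarrow> int.
        \<forall>y\<in>rank_set S leq (n - 1).
          (\<Sum>x\<in>rank_set S leq n. if covby S leq y x then f x else 0) = g y)"

text \<open>The matrix [DU_n] + x I over Z[x], w.r.t. the basis of P_n enumerated by the list es.
  Entry (i,j) is the coefficient of es!i in DU(es!j), i.e. the number of z covering both.\<close>
definition DU_plus_xI :: "'a set \<Rightarrow> ('a \<Rightarrow> 'a \<Rightarrow> bool) \<Rightarrow> 'a list \<Rightarrow> int poly mat" where
  "DU_plus_xI S leq es = mat (length es) (length es)
     (\<lambda>(i, j). of_nat (card {z\<in>S. covby S leq (es ! j) z \<and> covby S leq (es ! i) z})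
               + (if i = j then [:0, 1:] else 0))"

definition has_smith_normal_form :: "'a :: comm_ring_1 mat \<Rightarrow> bool" where
  "has_smith_normal_form A \<longleftrightarrow>
     (\<exists>P Q. P \<in> carrier_mat (dim_row A) (dim_row A) \<and> Q \<in> carrier_mat (dim_col A) (dim_col A) \<and>
        invertible_mat P \<and> invertible_mat Q \<and>
        diagonal_mat (P * A * Q) \<and>
        (\<forall>i. Suc i < min (dim_row A) (dim_col A) \<longrightarrow>
            (P * A * Q) $$ (i, i) dvd (P * A * Q) $$ (Suc i, Suc i)))"

end

theory Submission
  imports Defs "Jordan_Normal_Form.Determinant" "HOL-Library.Function_Algebras"
    "HOL-Library.Indicator_Function"
begin

text \<open>
  Being \<open>r\<close>-differential means \<open>D U = U D + r\<close>. So the product is \<open>(r + s)\<close>-differential, because its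
  operators are \<open>U\<^sub>P \<otimes> 1 + 1 \<otimes> U\<^sub>Q\<close> and \<open>D\<^sub>P \<otimes> 1 + 1 \<otimes> D\<^sub>Q\<close>. Its down maps are surjective, and the
  first differences \<open>d n\<close> of its rank sizes are strictly increasing, except that \<open>d 0 = d 1 = 1\<close> when
  \<open>r = s = 1\<close>.

  Consider any \<open>r\<close>-differential poset with these properties, and suppose that there are elements
  \<open>b i j\<close> of rank \<open>i\<close>, for \<open>j < d i\<close>, such that the \<open>U\<^bsup>n-i\<^esup> (b i j)\<close> form a basis of rank \<open>n\<close> and
  \<open>D (b i j)\<close> is \<open>b (i - 1) j\<close>, or \<open>0\<close> if \<open>j \<ge> d (i - 1)\<close>. In this basis \<open>D U + x\<close> is a sum of
  Jordan-like chains, one for each \<open>j\<close>, and each chain is equivalent to \<open>diag(1, \<dots>, 1, \<Prod>(x + k r))\<close>,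
  where longer chains have more factors.

  The \<open>b i j\<close> are built rank by rank. As \<open>D\<close> is surjective, the image of its transpose \<open>U\<close> has a
  complement \<open>C\<close> in rank \<open>n + 1\<close>, with a basis of \<open>d (n + 1)\<close> elements. By the chain decomposition at
  \<open>x = 0\<close>, the cokernel of \<open>D U\<close> on rank \<open>n\<close> is a sum of cyclic groups generated by the \<open>b n j\<close>, whose
  orders divide one another, and \<open>D\<close> maps \<open>C\<close> onto it. Since \<open>d n < d (n + 1)\<close>, some basis of \<open>C\<close> is
  mapped to these generators followed by zeros; in the exceptional case the cokernel has order \<open>2\<close>,
  which suffices. Subtracting elements of the image of \<open>U\<close> from this basis turns congruence modulo the
  image of \<open>D U\<close> into equality.
\<close>

section \<open>Spanning families\<close>

context Modules.module
begin

lemma span_image_finite: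
  assumes "finite I"
  shows "span (c ` I) = range (\<lambda>a. \<Sum>i\<in>I. a i *s c i)"
proof
  have "c i \<in> range (\<lambda>a. \<Sum>i\<in>I. a i *s c i)" if "i \<in> I" for i
    using assms that
    by (intro range_eqI[of _ _ "\<lambda>k. of_bool (k = i)"])
      (simp add: of_bool_def if_distrib[of "\<lambda>a. a *s _"] cong: if_cong)
  moreover have "subspace (range (\<lambda>a. \<Sum>i\<in>I. a i *s c i))"
  proof (rule subspaceI; clarify?)
    show "0 \<in> range (\<lambda>a. \<Sum>i\<in>I. a i *s c i)"
      by (rule range_eqI[of _ _ "\<lambda>_. 0"]) simp
    show "(\<Sum>i\<in>I. a i *s c i) + (\<Sum>i\<in>I. b i *s c i) \<in> range (\<lambda>a. \<Sum>i\<in>I. a i *s c i)" for a b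
      by (rule range_eqI[of _ _ "\<lambda>i. a i + b i"]) (simp add: scale_left_distrib sum.distrib)
    show "p *s (\<Sum>i\<in>I. a i *s c i) \<in> range (\<lambda>a. \<Sum>i\<in>I. a i *s c i)" for p a
      by (rule range_eqI[of _ _ "\<lambda>i. p * a i"]) (simp add: scale_sum_right)
  qed
  ultimately show "span (c ` I) \<subseteq> range (\<lambda>a. \<Sum>i\<in>I. a i *s c i)"
    by (intro span_minimal) auto
qed (auto intro!: span_sum span_scale intro: span_base)

lemma span_imageE:
  assumes "v \<in> span (c ` I)" "finite I"
  obtains a where "v = (\<Sum>i\<in>I. a i *s c i)"
  using assms by (auto simp: span_image_finite)

lemma span_image_transform2:
  assumes ij: "i \<in> I" "j \<in> I" "i \<noteq> j" and det: "p * t - q * u = 1"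
  shows "span (c(i := p *s c i + q *s c j, j := u *s c i + t *s c j) ` I) = span (c ` I)"
    (is "span (?c ` I) = _")
  unfolding span_eq
proof (intro conjI image_subsetI)
  show "?c k \<in> span (c ` I)" if "k \<in> I" for k
    using that ij by (auto intro!: span_add span_scale intro: span_base)
  have combination: "x *s ?c i + y *s ?c j \<in> span (?c ` I)" for x y
    using ij by (intro span_add span_scale span_base) auto
  have "t *s ?c i + (- q) *s ?c j = (p * t - q * u) *s c i"
    using ij by (simp add: algebra_simps)
  moreover have "(- u) *s ?c i + p *s ?c j = (p * t - q * u) *s c j"
    using ij by (simp add: algebra_simps)
  ultimately have "c i \<in> span (?c ` I)" "c j \<in> span (?c ` I)"
    using combination[of t "- q"] combination[of "- u" p] det by simp_all
  moreover have "c k \<in> span (?c ` I)" if "k \<in> I" "k \<noteq> i" "k \<noteq> j" for k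
    using that by (intro span_base) (simp add: rev_image_eqI)
  ultimately show "c k \<in> span (?c ` I)" if "k \<in> I" for k
    using that by blast
qed

lemma span_image_scale_unit:
  assumes "u * u' = 1"
  shows "span (c(i := u *s c i) ` I) = span (c ` I)"
proof -
  have "(c(i := u *s c i)) k \<in> span (c ` I)" if "k \<in> I" for k
    using that by (auto intro: span_scale span_base)
  moreover have "c k = (if k = i then u' else 1) *s (c(i := u *s c i)) k" for k
    using assms by (simp add: mult.commute)
  then have "c k \<in> span (c(i := u *s c i) ` I)" if "k \<in> I" for k
    using that by (metis imageI span_base span_scale)
  ultimately show ?thesis
    unfolding span_eq by blast
qed

lemma span_image_override:
  assumes "J \<subseteq> I" "span (t ` J) = span (c ` J)"
  shows "span ((\<lambda>k. if k \<in> J then t k else c k) ` I) = span (c ` I)"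
proof -
  have "(\<lambda>k. if k \<in> J then t k else c k) ` I = t ` J \<union> c ` (I - J)" "c ` I = c ` J \<union> c ` (I - J)"
    using assms(1) by auto
  then show ?thesis
    using assms(2) by (simp add: span_Un)
qed

lemma span_image_shear:
  assumes "j \<in> I" "j \<notin> H"
  shows "span ((\<lambda>k. if k \<in> H then c k - a k *s c j else c k) ` I) = span (c ` I)"
proof -
  define c' where "c' = (\<lambda>k. if k \<in> H then c k - a k *s c j else c k)"
  have c': "c k = c' k + (if k \<in> H then a k else 0) *s c' j" for k
    using assms by (simp add: c'_def)
  have "c' k \<in> span (c ` I)" if "k \<in> I" for k
    using that assms by (auto simp: c'_def intro!: span_diff span_scale intro: span_base)
  moreover have "c k \<in> span (c' ` I)" if "k \<in> I" for k
    using that assms by (subst c') (intro span_add span_scale span_base imageI)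
  ultimately have "span (c' ` I) = span (c ` I)"
    unfolding span_eq by auto
  then show ?thesis by (simp only: c'_def)
qed

end

definition units_lift_mod :: "'r :: comm_ring_1 \<Rightarrow> bool" where
  "units_lift_mod y \<longleftrightarrow> (\<forall>a b. y dvd a * b - 1 \<longrightarrow> (\<exists>u. u dvd 1 \<and> y dvd a - u))"

lemma units_lift_mod_0: "units_lift_mod 0"
  unfolding units_lift_mod_def by (metis diff_self dvd_0_left_iff dvd_triv_left eq_iff_diff_eq_0)

lemma units_lift_mod_2: "units_lift_mod (2 :: int)"
  unfolding units_lift_mod_def
proof (intro allI impI)
  fix a b :: int
  assume "2 dvd a * b - 1"
  then have "2 dvd a - 1" by auto
  then show "\<exists>u. u dvd 1 \<and> 2 dvd a - u" by (intro exI[of _ 1]) simp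
qed

locale euclidean_module = Modules.module scale
  for scale :: "'r :: euclidean_ring_gcd \<Rightarrow> 'v :: ab_group_add \<Rightarrow> 'v" (infixr \<open>*s\<close> 75)
begin

abbreviation linear_form :: "('v \<Rightarrow> 'r) \<Rightarrow> bool" where
  "linear_form \<equiv> Modules.module_hom scale (*)"

lemma ex_span_form_eq_0_on:
  assumes \<phi>: "linear_form \<phi>" and i: "i \<in> I"
  assumes "finite J" "J \<subseteq> I - {i}"
  shows "\<exists>c'. span (c' ` I) = span (c ` I) \<and> (\<forall>k\<in>J. \<phi> (c' k) = 0)"
  using assms(3,4)
proof (induction J)
  case empty
  then show ?case by auto
next
  case (insert j J)
  interpret \<phi>: Modules.module_hom scale "(*)" \<phi> by (rule \<phi>)
  from insert obtain c' where span: "span (c' ` I) = span (c ` I)" and zero: "\<And>k. k \<in> J \<Longrightarrow> \<phi> (c' k) = 0"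
    by auto
  define g where "g = gcd (\<phi> (c' i)) (\<phi> (c' j))"
  obtain a b where a: "\<phi> (c' i) = g * a" and b: "\<phi> (c' j) = g * b"
    unfolding g_def by (rule dvdE[OF gcd_dvd1], rule dvdE[OF gcd_dvd2]) blast
  obtain p q where "bezout_coefficients (\<phi> (c' i)) (\<phi> (c' j)) = (p, q)"
    by fastforce
  then have "p * \<phi> (c' i) + q * \<phi> (c' j) = g"
    unfolding g_def by (rule bezout_coefficients)
  moreover have "g * (p * a - q * (- b)) = p * \<phi> (c' i) + q * \<phi> (c' j)"
    unfolding a b by (simp add: distrib_left mult.left_commute)
  ultimately have bezout: "g * (p * a - q * (- b)) = g * 1"
    by simp
  show ?case
  proof (cases "g = 0")
    case True
    then show ?thesis using span zero b by auto
  next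
    case False
    define c'' where "c'' = c'(i := p *s c' i + q *s c' j, j := (- b) *s c' i + a *s c' j)"
    have "span (c'' ` I) = span (c ` I)"
      unfolding c''_def span[symmetric] using insert.prems i bezout False
      by (intro span_image_transform2) auto
    moreover have "\<phi> (c'' k) = 0" if "k \<in> insert j J" for k
      using that insert.prems zero by (auto simp: c''_def \<phi>.add \<phi>.diff \<phi>.scale \<phi>.neg a b)
    ultimately show ?thesis by blast
  qed
qed

lemma ex_span_form_inverse_mod:
  assumes \<phi>: "linear_form \<phi>" and I: "finite I" "i \<in> I"
    and v: "v \<in> span (c ` I)" "y dvd \<phi> v - 1"
  obtains c' a where "span (c' ` I) = span (c ` I)" "\<And>k. k \<in> I - {i} \<Longrightarrow> \<phi> (c' k) = 0"
    "y dvd \<phi> (c' i) * a - 1"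
proof -
  interpret \<phi>: Modules.module_hom scale "(*)" \<phi> by (rule \<phi>)
  obtain c' where span: "span (c' ` I) = span (c ` I)" and zero: "\<And>k. k \<in> I - {i} \<Longrightarrow> \<phi> (c' k) = 0"
    using ex_span_form_eq_0_on[OF \<phi> I(2) finite_Diff[OF I(1)] subset_refl, of c] by auto
  obtain a where "v = (\<Sum>k\<in>I. a k *s c' k)"
    using v(1)[folded span] I(1) by (rule span_imageE)
  then have "\<phi> v = (\<Sum>k\<in>I. a k * \<phi> (c' k))"
    by (simp add: \<phi>.sum \<phi>.scale)
  also have "\<dots> = \<phi> (c' i) * a i"
    using I zero by (simp add: sum.remove[of I i] mult.commute)
  finally have "y dvd \<phi> (c' i) * a i - 1"
    using v(2) by simp
  with span zero show ?thesis by (rule that)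
qed

lemma ex_span_form_unit_mod:
  assumes \<phi>: "linear_form \<phi>" and I: "finite I" "i \<in> I"
    and unit: "units_lift_mod y \<or> I \<noteq> {i}"
    and v: "v \<in> span (c ` I)" "y dvd \<phi> v - 1"
  shows "\<exists>c'. span (c' ` I) = span (c ` I) \<and> (\<forall>k\<in>I. y dvd \<phi> (c' k) - of_bool (k = i))"
proof -
  interpret \<phi>: Modules.module_hom scale "(*)" \<phi> by (rule \<phi>)
  obtain c' a where span: "span (c' ` I) = span (c ` I)" and zero: "\<And>k. k \<in> I - {i} \<Longrightarrow> \<phi> (c' k) = 0"
    and inverse: "y dvd \<phi> (c' i) * a - 1"
    using ex_span_form_inverse_mod[OF \<phi> I v] by blast
  have "\<exists>c''. span (c'' ` I) = span (c' ` I) \<and> (\<forall>k\<in>I. y dvd \<phi> (c'' k) - of_bool (k = i))"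
  proof (cases "units_lift_mod y")
    case True
    then obtain u where u: "u dvd 1" "y dvd \<phi> (c' i) - u"
      using inverse unfolding units_lift_mod_def by blast
    from u(1) obtain u' where u': "1 = u * u'" by (rule dvdE)
    let ?c = "c'(i := u' *s c' i)"
    have "\<phi> (?c i) - 1 = u' * (\<phi> (c' i) - u)"
      using u' by (simp add: \<phi>.scale algebra_simps)
    then have "y dvd \<phi> (?c k) - of_bool (k = i)" if "k \<in> I" for k
      using that zero u(2) by (cases "k = i") auto
    moreover have "span (?c ` I) = span (c' ` I)"
      using u' by (intro span_image_scale_unit[of _ u]) (simp add: mult.commute)
    ultimately show ?thesis by blast
  next
    case False
    then obtain j where j: "j \<in> I" "j \<noteq> i" using unit I by blast
    from inverse obtain q where q: "a * \<phi> (c' i) - q * y = 1"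
      by (metis add_diff_cancel_left' diff_add_cancel dvdE mult.commute)
    let ?c = "c'(i := a *s c' i + q *s c' j, j := y *s c' i + \<phi> (c' i) *s c' j)"
    have "\<phi> (?c i) - 1 = y * q" "\<phi> (?c j) = y * \<phi> (c' i)"
      using j q zero[of j] by (simp_all add: \<phi>.add \<phi>.scale algebra_simps)
    then have "y dvd \<phi> (?c k) - of_bool (k = i)" if "k \<in> I" for k
      using that j zero by (cases "k = i \<or> k = j") auto
    moreover have "span (?c ` I) = span (c' ` I)"
      using I j q by (intro span_image_transform2) auto
    ultimately show ?thesis by blast
  qed
  then show ?thesis using span by simp
qed

definition dual_mod :: "(nat \<Rightarrow> 'v \<Rightarrow> 'r) \<Rightarrow> (nat \<Rightarrow> 'r) \<Rightarrow> nat \<Rightarrow> nat \<Rightarrow> (nat \<Rightarrow> 'v) \<Rightarrow> bool" where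
  "dual_mod \<phi> y d D c \<longleftrightarrow> (\<forall>k<D. \<forall>j<d. y j dvd \<phi> j (c k) - of_bool (k = j))"

lemma dual_mod_coefficient:
  assumes \<phi>: "linear_form (\<phi> j)" and dual: "dual_mod \<phi> y d D c" and "j < d" "d \<le> D"
  shows "y j dvd \<phi> j (\<Sum>k<D. a k *s c k) - a j"
proof -
  interpret \<phi>: Modules.module_hom scale "(*)" "\<phi> j" by (rule \<phi>)
  have "(\<Sum>k<D. a k * of_bool (k = j)) = a j"
    using assms by (simp add: of_bool_def if_distrib[of "(*) _"] cong: if_cong)
  then have "\<phi> j (\<Sum>k<D. a k *s c k) - a j = (\<Sum>k<D. a k * (\<phi> j (c k) - of_bool (k = j)))"
    by (simp add: \<phi>.sum \<phi>.scale right_diff_distrib sum_subtractf)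
  then show ?thesis
    using dual \<open>j < d\<close> by (auto simp: dual_mod_def intro!: dvd_sum)
qed

lemma dual_mod_tail_unit:
  assumes \<phi>: "\<And>j. linear_form (\<phi> j)" and dual: "dual_mod \<phi> y d D c" and "d < D"
    and y: "\<And>j. j < d \<Longrightarrow> y d dvd y j"
    and v: "v \<in> span (c ` {..<D})" "\<And>j. j \<le> d \<Longrightarrow> y j dvd \<phi> j v - of_bool (j = d)"
  shows "\<exists>w\<in>span (c ` {d..<D}). y d dvd \<phi> d w - 1"
proof -
  interpret \<phi>: Modules.module_hom scale "(*)" "\<phi> d" by (rule \<phi>)
  obtain a where a: "v = (\<Sum>k<D. a k *s c k)"
    using v(1) by (rule span_imageE) simp
  have "y d dvd a j" if "j < d" for j
  proof -
    have "y j dvd \<phi> j v" "y j dvd \<phi> j v - a j"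
      using v(2)[of j] dual_mod_coefficient[OF \<phi> dual that, of a] that \<open>d < D\<close> by (simp_all add: a)
    then have "y j dvd a j" by (metis dvd_diff_right_iff)
    then show ?thesis using y[OF that] by (rule dvd_trans[rotated])
  qed
  then have "y d dvd \<phi> d (\<Sum>k<d. a k *s c k)"
    by (auto simp: \<phi>.sum \<phi>.scale intro!: dvd_sum)
  moreover define w where "w = (\<Sum>k\<in>{d..<D}. a k *s c k)"
  have "v = (\<Sum>k<d. a k *s c k) + w"
    using \<open>d < D\<close> by (simp add: a w_def lessThan_atLeast0 sum.atLeastLessThan_concat)
  then have "\<phi> d v - 1 - \<phi> d (\<Sum>k<d. a k *s c k) = \<phi> d w - 1"
    by (simp add: \<phi>.add)
  ultimately have "y d dvd \<phi> d w - 1"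
    using v(2)[of d] by (metis dvd_diff of_bool_eq(2) order_refl)
  then show ?thesis
    unfolding w_def by (intro bexI) (auto intro!: span_sum span_scale intro: span_base)
qed

lemma dual_mod_override:
  assumes \<phi>: "\<And>j. linear_form (\<phi> j)" and dual: "dual_mod \<phi> y d D c"
    and t: "t ` {d..<D} \<subseteq> span (c ` {d..<D})"
  shows "dual_mod \<phi> y d D (\<lambda>k. if k \<in> {d..<D} then t k else c k)"
  unfolding dual_mod_def
proof (intro allI impI)
  fix k j assume "k < D" "j < d"
  interpret \<phi>: Modules.module_hom scale "(*)" "\<phi> j" by (rule \<phi>)
  show "y j dvd \<phi> j (if k \<in> {d..<D} then t k else c k) - of_bool (k = j)"
  proof (cases "d \<le> k")
    case True
    then have "t k \<in> span (c ` {d..<D})" using t \<open>k < D\<close> by auto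
    then obtain a where a: "t k = (\<Sum>l\<in>{d..<D}. a l *s c l)" by (rule span_imageE) simp
    have "y j dvd \<phi> j (c l)" if "d \<le> l" "l < D" for l
    proof -
      have "y j dvd \<phi> j (c l) - of_bool (l = j)" using dual that \<open>j < d\<close> unfolding dual_mod_def by blast
      then show ?thesis using that \<open>j < d\<close> by simp
    qed
    then have "y j dvd \<phi> j (t k)"
      unfolding a by (auto simp: \<phi>.sum \<phi>.scale intro!: dvd_sum)
    then show ?thesis using True \<open>k < D\<close> \<open>j < d\<close> by simp
  qed (use dual \<open>k < D\<close> \<open>j < d\<close> in \<open>simp add: dual_mod_def\<close>)
qed

lemma dual_mod_shear:
  assumes \<phi>: "\<And>j. linear_form (\<phi> j)" and dual: "dual_mod \<phi> y d D c" and "d < D"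
    and tail: "\<And>k. d \<le> k \<Longrightarrow> k < D \<Longrightarrow> y d dvd \<phi> d (c k) - of_bool (k = d)"
  shows "dual_mod \<phi> y (Suc d) D (\<lambda>k. if k \<in> {..<d} then c k - \<phi> d (c k) *s c d else c k)"
    (is "dual_mod \<phi> y _ D ?c")
  unfolding dual_mod_def
proof (intro allI impI)
  fix k j assume k: "k < D" and j: "j < Suc d"
  interpret \<phi>: Modules.module_hom scale "(*)" "\<phi> j" by (rule \<phi>)
  have head: "\<phi> j (?c k) = \<phi> j (c k) - \<phi> d (c k) * \<phi> j (c d)" if "k < d"
    using that by (simp add: \<phi>.diff \<phi>.scale)
  show "y j dvd \<phi> j (?c k) - of_bool (k = j)"
  proof (cases "j = d")
    case True
    have "y d dvd \<phi> d (?c k)" if "k < d"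
    proof -
      have "\<phi> d (?c k) = \<phi> d (c k) * - (\<phi> d (c d) - of_bool (d = d))"
        using head[OF that] True by (simp add: right_diff_distrib)
      then show ?thesis
        using tail[of d] \<open>d < D\<close> by (metis dvd_minus_iff dvd_mult order_refl)
    qed
    then show ?thesis using True k tail[of k] by (cases "k < d") auto
  next
    case False
    have dual_j: "y j dvd \<phi> j (c l) - of_bool (l = j)" if "l < D" for l
      using dual that j False by (simp add: dual_mod_def)
    then have "y j dvd \<phi> d (c k) * \<phi> j (c d)"
      using \<open>d < D\<close> False by (metis diff_zero dvd_mult of_bool_eq(1))
    then have "y j dvd (\<phi> j (c k) - of_bool (k = j)) - \<phi> d (c k) * \<phi> j (c d)"
      by (rule dvd_diff[OF dual_j[OF k]])
    then have "y j dvd \<phi> j (c k) - \<phi> d (c k) * \<phi> j (c d) - of_bool (k = j)"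
      by (simp only: diff_diff_eq add.commute)
    then show ?thesis
      using head dual_j[OF k] by (cases "k < d") (simp_all split del: split_of_bool)
  qed
qed

text \<open>
  The family \<open>c'\<close> arises from \<open>c\<close> by a unimodular matrix. For \<open>d = D\<close> this forces the determinant of
  \<open>\<phi> j (c k)\<close> to be congruent to a unit modulo \<open>y (d - 1)\<close>, whence the hypothesis on \<open>y (d - 1)\<close>.
\<close>

lemma ex_span_dual_mod:
  assumes \<phi>: "\<And>j. linear_form (\<phi> j)" and "d \<le> D"
    and "d = D \<Longrightarrow> 0 < d \<Longrightarrow> units_lift_mod (y (d - 1))"
    and "\<And>i j. i \<le> j \<Longrightarrow> j < d \<Longrightarrow> y j dvd y i"
    and "\<And>i. i < d \<Longrightarrow> \<exists>v\<in>span (c ` {..<D}). \<forall>j<d. y j dvd \<phi> j v - of_bool (j = i)"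
  shows "\<exists>c'. span (c' ` {..<D}) = span (c ` {..<D}) \<and> dual_mod \<phi> y d D c'"
  using assms(2-)
proof (induction d)
  case 0
  then show ?case by (auto simp: dual_mod_def)
next
  case (Suc d)
  have "d < D" using Suc.prems(1) by simp
  have "\<exists>v\<in>span (c ` {..<D}). \<forall>j<d. y j dvd \<phi> j v - of_bool (j = i)" if "i < d" for i
    using Suc.prems(4)[OF less_SucI[OF that]] less_SucI by (elim bexE) blast
  then obtain c' where span: "span (c' ` {..<D}) = span (c ` {..<D})" and dual: "dual_mod \<phi> y d D c'"
    using Suc.IH Suc.prems(3) \<open>d < D\<close> by auto
  obtain v where "v \<in> span (c' ` {..<D})" "\<And>j. j \<le> d \<Longrightarrow> y j dvd \<phi> j v - of_bool (j = d)"
    using Suc.prems(4)[of d] span by (auto simp: less_Suc_eq_le)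
  then obtain w where w: "w \<in> span (c' ` {d..<D})" "y d dvd \<phi> d w - 1"
    using dual_mod_tail_unit[OF \<phi> dual \<open>d < D\<close>] Suc.prems(3) by (meson lessI less_imp_le_nat)
  have "D = Suc d" if "{d..<D} = {d}"
    using arg_cong[OF that, of card] \<open>d < D\<close> by simp
  then have "units_lift_mod (y d) \<or> {d..<D} \<noteq> {d}"
    using Suc.prems(2) by auto
  from ex_span_form_unit_mod[OF \<phi> _ _ this w] obtain t
    where span_t: "span (t ` {d..<D}) = span (c' ` {d..<D})"
      and t: "\<And>k. d \<le> k \<Longrightarrow> k < D \<Longrightarrow> y d dvd \<phi> d (t k) - of_bool (k = d)"
    using \<open>d < D\<close> by auto
  define c'' where "c'' k = (if k \<in> {d..<D} then t k else c' k)" for k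
  have "span (c'' ` {..<D}) = span (c ` {..<D})"
    unfolding c''_def span[symmetric] using span_t by (intro span_image_override) auto
  moreover have "dual_mod \<phi> y d D c''"
    unfolding c''_def using span_t span_superset by (intro dual_mod_override \<phi> dual) blast
  then have "dual_mod \<phi> y (Suc d) D (\<lambda>k. if k \<in> {..<d} then c'' k - \<phi> d (c'' k) *s c'' d else c'' k)"
    by (rule dual_mod_shear[OF \<phi> _ \<open>d < D\<close>]) (simp add: c''_def t)
  moreover have "span ((\<lambda>k. if k \<in> {..<d} then c'' k - \<phi> d (c'' k) *s c'' d else c'' k) ` {..<D})
      = span (c'' ` {..<D})"
    using \<open>d < D\<close> by (intro span_image_shear) auto
  ultimately show ?case by metis
qed

lemma span_tail_if_forms_eq_0:
  assumes \<phi>: "\<And>j. linear_form (\<phi> j)" and dual: "dual_mod \<phi> (\<lambda>_. 0) p q c" and "p \<le> q"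
    and v: "v \<in> span (c ` {..<q})" "\<And>j. j < p \<Longrightarrow> \<phi> j v = 0"
  shows "v \<in> span (c ` {p..<q})"
proof -
  obtain a where a: "v = (\<Sum>k<q. a k *s c k)"
    using v(1) by (rule span_imageE) simp
  have "a j = 0" if "j < p" for j
    using dual_mod_coefficient[OF \<phi> dual that \<open>p \<le> q\<close>, of a] v(2)[OF that] by (simp add: a)
  then have "v = (\<Sum>k\<in>{p..<q}. a k *s c k)"
    unfolding a by (intro sum.mono_neutral_right) auto
  also have "\<dots> \<in> span (c ` {p..<q})"
    by (intro span_sum span_scale span_base imageI)
  finally show ?thesis .
qed

lemma form_eq_0_after_projection:
  fixes \<phi> :: "nat \<Rightarrow> 'v \<Rightarrow> 'r"
  assumes \<phi>: "linear_form (\<phi> j)" and \<phi>u: "\<And>i. i < p \<Longrightarrow> \<phi> j (u i) = of_bool (j = i)" and "j < p"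
  shows "\<phi> j (v - (\<Sum>i<p. \<phi> i v *s u i)) = 0"
proof -
  interpret \<phi>: Modules.module_hom scale "(*)" "\<phi> j" by (rule \<phi>)
  have "\<phi> j (\<Sum>i<p. \<phi> i v *s u i) = (\<Sum>i<p. \<phi> i v * of_bool (j = i))"
    using \<phi>u by (simp add: \<phi>.sum \<phi>.scale)
  also have "\<dots> = \<phi> j v"
    using \<open>j < p\<close> by (simp add: of_bool_def if_distrib[of "(*) _"] cong: if_cong)
  finally show ?thesis
    by (simp add: \<phi>.diff)
qed

lemma ex_span_complement:
  fixes \<phi> :: "nat \<Rightarrow> 'v \<Rightarrow> 'r"
  assumes \<phi>: "\<And>j. linear_form (\<phi> j)" and "p \<le> q"
    and u: "\<And>j. j < p \<Longrightarrow> u j \<in> span (c ` {..<q})"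
    and \<phi>u: "\<And>i j. i < p \<Longrightarrow> j < p \<Longrightarrow> \<phi> j (u i) = of_bool (j = i)"
  shows "\<exists>c'. span (u ` {..<p} \<union> c' ` {..<q - p}) = span (c ` {..<q})"
proof -
  have "\<exists>c'. span (c' ` {..<q}) = span (c ` {..<q}) \<and> dual_mod \<phi> (\<lambda>_. 0) p q c'"
  proof (rule ex_span_dual_mod[OF \<phi> \<open>p \<le> q\<close>])
    show "\<exists>v\<in>span (c ` {..<q}). \<forall>j<p. 0 dvd \<phi> j v - of_bool (j = i)" if "i < p" for i
      using u[OF that] \<phi>u that by (intro bexI[of _ "u i"]) auto
  qed (simp_all add: units_lift_mod_0)
  then obtain c' where span: "span (c' ` {..<q}) = span (c ` {..<q})" and dual: "dual_mod \<phi> (\<lambda>_. 0) p q c'"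
    by blast
  have tail: "(\<lambda>k. c' (p + k)) ` {..<q - p} = c' ` {p..<q}"
    using \<open>p \<le> q\<close> image_add_atLeastLessThan[of p 0 "q - p"]
    by (simp add: image_image[symmetric] lessThan_atLeast0)
  have "v \<in> span (u ` {..<p} \<union> c' ` {p..<q})" if v: "v \<in> span (c ` {..<q})" for v
  proof -
    define w where "w = (\<Sum>j<p. \<phi> j v *s u j)"
    have "v - w \<in> span (c' ` {p..<q})"
    proof (rule span_tail_if_forms_eq_0[OF \<phi> dual \<open>p \<le> q\<close>])
      show "v - w \<in> span (c' ` {..<q})"
        unfolding span w_def using u by (intro span_diff[OF v] span_sum span_scale) auto
      show "\<phi> j (v - w) = 0" if "j < p" for j
        unfolding w_def using \<phi> \<phi>u that by (intro form_eq_0_after_projection)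
    qed
    moreover have "w \<in> span (u ` {..<p})"
      unfolding w_def by (intro span_sum span_scale span_base) auto
    ultimately have "w + (v - w) \<in> span (u ` {..<p} \<union> c' ` {p..<q})"
      unfolding span_Un by blast
    then show ?thesis by simp
  qed
  moreover have "u ` {..<p} \<union> c' ` {p..<q} \<subseteq> span (c ` {..<q})"
    using u span span_superset[of "c' ` {..<q}"] by auto
  ultimately show ?thesis
    by (metis tail span_minimal subset_antisym subsetI subspace_span)
qed

end

section \<open>Free modules of functions and their matrices\<close>

definition scale_fun :: "'r :: comm_ring_1 \<Rightarrow> ('x \<Rightarrow> 'r) \<Rightarrow> 'x \<Rightarrow> 'r" (infixr \<open>*\<^sub>f\<close> 75) where
  "a *\<^sub>f f = (\<lambda>x. a * f x)"

lemma scale_fun_apply [simp]: "(a *\<^sub>f f) x = a * f x"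
  by (simp add: scale_fun_def)

interpretation fun_module: Modules.module scale_fun
  by standard (auto simp: fun_eq_iff algebra_simps)

interpretation int_fun_module: euclidean_module "scale_fun :: int \<Rightarrow> ('x \<Rightarrow> int) \<Rightarrow> 'x \<Rightarrow> int" ..

abbreviation linear_map :: "(('x \<Rightarrow> 'r :: comm_ring_1) \<Rightarrow> 'y \<Rightarrow> 'r) \<Rightarrow> bool" where
  "linear_map \<equiv> Modules.module_hom scale_fun scale_fun"

abbreviation linear_form :: "(('x \<Rightarrow> 'r :: comm_ring_1) \<Rightarrow> 'r) \<Rightarrow> bool" where
  "linear_form \<equiv> Modules.module_hom scale_fun (*)"

lemma linear_mapI:
  assumes "\<And>f g. T (f + g) = T f + T g" "\<And>a f. T (a *\<^sub>f f) = a *\<^sub>f T f"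
  shows "linear_map T"
  using assms by unfold_locales

lemma linear_formI:
  assumes "\<And>f g. \<phi> (f + g) = \<phi> f + \<phi> g" "\<And>a f. \<phi> (a *\<^sub>f f) = a * \<phi> f"
  shows "linear_form \<phi>"
  using assms by unfold_locales (auto simp: algebra_simps)

lemma sum_fun_apply: "(\<Sum>i\<in>I. f i) x = (\<Sum>i\<in>I. f i x)"
  by (induction I rule: infinite_finite_induct) auto

definition free_module :: "'x set \<Rightarrow> ('x \<Rightarrow> 'r :: zero) set" where
  "free_module X = {f. \<forall>x. x \<notin> X \<longrightarrow> f x = 0}"

lemma subspace_free_module: "fun_module.subspace (free_module X)"
  by (rule fun_module.subspaceI) (auto simp: free_module_def)

lemma indicator_in_free_module: "x \<in> X \<Longrightarrow> indicator {x} \<in> free_module X"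
  by (auto simp: free_module_def indicator_def)

lemma free_module_expand:
  assumes "finite X" "f \<in> free_module X"
  shows "f = (\<Sum>x\<in>X. f x *\<^sub>f indicator {x})"
proof
  fix y
  have "(\<Sum>x\<in>X. f x *\<^sub>f indicator {x}) y = (\<Sum>x\<in>X. if y = x then f x else 0)"
    unfolding sum_fun_apply by (rule sum.cong) (auto simp: indicator_def)
  also have "\<dots> = f y"
    using assms by (auto simp: free_module_def)
  finally show "f y = (\<Sum>x\<in>X. f x *\<^sub>f indicator {x}) y" ..
qed

lemma free_module_subset_span:
  assumes "finite X" "\<And>x. x \<in> X \<Longrightarrow> indicator {x} \<in> fun_module.span C"
  shows "free_module X \<subseteq> fun_module.span C"
proof
  fix f :: "'a \<Rightarrow> 'b"
  assume "f \<in> free_module X"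
  then have "f = (\<Sum>x\<in>X. f x *\<^sub>f indicator {x})"
    using assms(1) by (intro free_module_expand)
  also have "\<dots> \<in> fun_module.span C"
    using assms(2) by (intro fun_module.span_sum fun_module.span_scale)
  finally show "f \<in> fun_module.span C" .
qed

lemma span_indicator:
  assumes "finite X"
  shows "fun_module.span ((\<lambda>x. indicator {x}) ` X) = free_module X"
proof
  show "fun_module.span ((\<lambda>x. indicator {x}) ` X) \<subseteq> free_module X"
    by (intro fun_module.span_minimal subspace_free_module) (auto intro: indicator_in_free_module)
  show "free_module X \<subseteq> fun_module.span ((\<lambda>x. indicator {x}) ` X)"
    using assms by (intro free_module_subset_span fun_module.span_base imageI)
qed

lemma inj_indicator: "inj_on (\<lambda>x. indicator {x} :: 'x \<Rightarrow> 'r :: zero_neq_one) X"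
  by (auto simp: inj_on_def indicator_def fun_eq_iff split: if_splits)

lemma independent_indicator:
  assumes "finite X"
  shows "fun_module.independent ((\<lambda>x. indicator {x} :: 'x \<Rightarrow> 'r :: comm_ring_1) ` X)"
    (is "fun_module.independent ?I")
proof
  assume "fun_module.dependent ?I"
  then obtain u x where u: "x \<in> X" "u (indicator {x}) \<noteq> 0" "(\<Sum>v\<in>?I. u v *\<^sub>f v) = 0"
    unfolding fun_module.dependent_finite[OF finite_imageI[OF assms]] by auto
  have "(\<Sum>v\<in>?I. u v *\<^sub>f v) x = (\<Sum>y\<in>X. if y = x then u (indicator {x}) else 0)"
    unfolding sum.reindex[OF inj_indicator] sum_fun_apply by (intro sum.cong) (auto simp: indicator_def)
  then show False
    using u assms by simp
qed

lemma free_module_subset_span_of_int: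
  fixes c :: "'k \<Rightarrow> 'x \<Rightarrow> int"
  assumes fin: "finite X" "finite K" and span: "free_module X \<subseteq> fun_module.span (c ` K)"
  shows "free_module X \<subseteq> fun_module.span ((\<lambda>k x. of_int (c k x) :: 'r :: comm_ring_1) ` K)"
proof (rule free_module_subset_span[OF fin(1)])
  fix y assume "y \<in> X"
  then have "indicator {y} \<in> fun_module.span (c ` K)"
    by (intro subsetD[OF span] indicator_in_free_module)
  then obtain a where a: "indicator {y} = (\<Sum>k\<in>K. a k *\<^sub>f c k)"
    using fin(2) by (rule fun_module.span_imageE)
  have "indicator {y} x = (of_int (indicator {y} x) :: 'r)" for x
    by (simp add: indicator_def)
  then have "indicator {y} = (\<Sum>k\<in>K. of_int (a k) *\<^sub>f (\<lambda>x. of_int (c k x) :: 'r))"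
    unfolding a by (simp add: fun_eq_iff sum_fun_apply)
  also have "\<dots> \<in> fun_module.span ((\<lambda>k x. of_int (c k x)) ` K)"
    by (intro fun_module.span_sum fun_module.span_scale fun_module.span_base imageI)
  finally show "indicator {y} \<in> fun_module.span ((\<lambda>k x. of_int (c k x) :: 'r) ` K)" .
qed

lemma card_le_of_injective_linear_map:
  fixes T :: "('x \<Rightarrow> 'r :: field) \<Rightarrow> 'y \<Rightarrow> 'r"
  assumes fin: "finite X" "finite Y" and T: "linear_map T" "T ` free_module X \<subseteq> free_module Y"
    and inj: "\<And>f. f \<in> free_module X \<Longrightarrow> T f = 0 \<Longrightarrow> f = 0"
  shows "card X \<le> card Y"
proof -
  interpret field_X: vector_space "scale_fun :: 'r \<Rightarrow> ('x \<Rightarrow> 'r) \<Rightarrow> 'x \<Rightarrow> 'r"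
    by standard (auto simp: fun_eq_iff algebra_simps)
  interpret field_Y: vector_space "scale_fun :: 'r \<Rightarrow> ('y \<Rightarrow> 'r) \<Rightarrow> 'y \<Rightarrow> 'r"
    by standard (auto simp: fun_eq_iff algebra_simps)
  interpret T: Modules.module_hom scale_fun scale_fun T by (rule T)
  let ?X = "(\<lambda>x. indicator {x} :: 'x \<Rightarrow> 'r) ` X" and ?Y = "(\<lambda>y. indicator {y} :: 'y \<Rightarrow> 'r) ` Y"
  have span_X: "fun_module.span ?X = free_module X" and span_Y: "fun_module.span ?Y = free_module Y"
    using fin by (simp_all add: span_indicator)
  have inj_T: "inj_on T (fun_module.span ?X)"
    unfolding span_X T.inj_on_iff_eq_0[OF subspace_free_module] using inj by blast
  have "fun_module.independent ?X"
    using fin(1) by (rule independent_indicator)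
  then have "fun_module.independent (T ` ?X)"
    using inj_T by (rule T.independent_injective_image)
  moreover have "T ` ?X \<subseteq> fun_module.span ?Y"
    unfolding span_Y using T(2) by (auto intro: indicator_in_free_module)
  ultimately have "card (T ` ?X) \<le> card ?Y"
    using field_Y.independent_span_bound[of ?Y "T ` ?X"] fin(2) by auto
  moreover have "card (T ` ?X) = card ?X"
    by (intro card_image inj_on_subset[OF inj_T] fun_module.span_superset)
  moreover have "card ?X = card X" "card ?Y = card Y"
    by (simp_all add: card_image inj_indicator)
  ultimately show ?thesis by simp
qed

definition family_mat :: "'x list \<Rightarrow> ('k \<Rightarrow> 'x \<Rightarrow> 'r) \<Rightarrow> 'k list \<Rightarrow> 'r mat" where
  "family_mat xs c ks = mat (length xs) (length ks) (\<lambda>(i, k). c (ks ! k) (xs ! i))"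

lemma family_mat_eq_iff:
  "family_mat xs c ks = family_mat xs c' ks \<longleftrightarrow> (\<forall>k\<in>set ks. \<forall>x\<in>set xs. c k x = c' k x)"
  by (auto simp: family_mat_def mat_eq_iff all_set_conv_all_nth)

lemma family_mat_indicator: "distinct xs \<Longrightarrow> family_mat xs (\<lambda>x. indicator {x}) xs = 1\<^sub>m (length xs)"
  by (rule eq_matI) (auto simp: family_mat_def indicator_def nth_eq_iff_index_eq)

lemma family_mat_mult:
  assumes "distinct ks"
  shows "family_mat xs c ks * family_mat ks a js = family_mat xs (\<lambda>j. \<Sum>k\<in>set ks. a j k *\<^sub>f c k) js"
proof (rule eq_matI)
  fix i j assume ij: "i < dim_row (family_mat xs (\<lambda>j. \<Sum>k\<in>set ks. a j k *\<^sub>f c k) js)"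
    "j < dim_col (family_mat xs (\<lambda>j. \<Sum>k\<in>set ks. a j k *\<^sub>f c k) js)"
  have bij: "bij_betw (\<lambda>k. ks ! k) {0..<length ks} (set ks)"
    using assms by (intro bij_betw_nth) auto
  have "(family_mat xs c ks * family_mat ks a js) $$ (i, j)
      = (\<Sum>k\<in>{0..<length ks}. a (js ! j) (ks ! k) * c (ks ! k) (xs ! i))"
    using ij by (simp add: family_mat_def scalar_prod_def mult.commute)
  also have "\<dots> = (\<Sum>k\<in>set ks. a (js ! j) k * c k (xs ! i))"
    by (rule sum.reindex_bij_betw[OF bij])
  also have "\<dots> = family_mat xs (\<lambda>j. \<Sum>k\<in>set ks. a j k *\<^sub>f c k) js $$ (i, j)"
    using ij by (simp add: family_mat_def sum_fun_apply)
  finally show "(family_mat xs c ks * family_mat ks a js) $$ (i, j)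
      = family_mat xs (\<lambda>j. \<Sum>k\<in>set ks. a j k *\<^sub>f c k) js $$ (i, j)" .
qed (simp_all add: family_mat_def)

lemma mat_right_inverse_imp_left_inverse:
  fixes A :: "'r :: comm_ring_1 mat"
  assumes A: "A \<in> carrier_mat n n" and B: "B \<in> carrier_mat n n" and AB: "A * B = 1\<^sub>m n"
  shows "B * A = 1\<^sub>m n"
proof -
  note adj = adj_mat[OF A]
  have "adj_mat A = adj_mat A * (A * B)"
    using AB adj by simp
  also have "\<dots> = adj_mat A * A * B"
    using adj A B by (intro assoc_mult_mat[symmetric]) auto
  also have "\<dots> = det A \<cdot>\<^sub>m B"
    using adj A B by (simp add: mult_smult_assoc_mat[of _ n n _ n])
  finally have "det A \<cdot>\<^sub>m (B * A) = det A \<cdot>\<^sub>m 1\<^sub>m n"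
    using adj(3) A B by (simp add: mult_smult_assoc_mat[of _ n n _ n])
  moreover have "det B \<cdot>\<^sub>m (det A \<cdot>\<^sub>m C) = C" for C
  proof -
    have "det B * det A = 1"
      using det_mult[OF A B] AB by (simp add: mult.commute)
    then show ?thesis by (intro eq_matI) (auto simp: mult.assoc[symmetric])
  qed
  ultimately show ?thesis by metis
qed

lemma family_mat_inverse:
  fixes c :: "'k \<Rightarrow> 'x \<Rightarrow> 'r :: comm_ring_1"
  assumes lists: "distinct xs" "distinct ks" "length ks = length xs"
    and span: "free_module (set xs) \<subseteq> fun_module.span (c ` set ks)"
  obtains a where "family_mat xs c ks * family_mat ks a xs = 1\<^sub>m (length xs)"
    "family_mat ks a xs * family_mat xs c ks = 1\<^sub>m (length xs)"
proof -
  define F where "F = (\<lambda>a. \<Sum>k\<in>set ks. a k *\<^sub>f c k)"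
  have range_F: "fun_module.span (c ` set ks) = range F"
    unfolding F_def by (rule fun_module.span_image_finite) simp
  define a where "a x = inv_into UNIV F (indicator {x})" for x
  have a: "F (a x) = indicator {x}" if "x \<in> set xs" for x
    unfolding a_def using subsetD[OF span[unfolded range_F] indicator_in_free_module[OF that]]
    by (rule f_inv_into_f)
  have "family_mat xs c ks * family_mat ks a xs = family_mat xs (\<lambda>x. F (a x)) xs"
    unfolding F_def by (rule family_mat_mult[OF lists(2)])
  also have "\<dots> = 1\<^sub>m (length xs)"
    unfolding family_mat_indicator[OF lists(1), symmetric] family_mat_eq_iff by (simp add: a)
  finally have right: "family_mat xs c ks * family_mat ks a xs = 1\<^sub>m (length xs)" .
  show ?thesis
  proof (rule that[OF right mat_right_inverse_imp_left_inverse[OF _ _ right]])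
    show "family_mat xs c ks \<in> carrier_mat (length xs) (length xs)"
      "family_mat ks a xs \<in> carrier_mat (length xs) (length xs)"
      using lists(3) by (simp_all add: family_mat_def)
  qed
qed

lemma invertible_family_mat:
  assumes "distinct xs" "distinct ks" "length ks = length xs"
    and "free_module (set xs) \<subseteq> fun_module.span (c ` set ks)"
  shows "invertible_mat (family_mat xs c ks)"
proof -
  obtain a where "family_mat xs c ks * family_mat ks a xs = 1\<^sub>m (length xs)"
    "family_mat ks a xs * family_mat xs c ks = 1\<^sub>m (length xs)"
    using family_mat_inverse[OF assms] .
  then show ?thesis
    using assms(3) unfolding invertible_mat_def inverts_mat_def by (auto simp: family_mat_def intro!: exI)
qed

lemma family_mat_scale:
  assumes "distinct ks"
  shows "family_mat xs (\<lambda>k. s k *\<^sub>f c k) ks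
    = family_mat xs c ks * family_mat ks (\<lambda>k. s k *\<^sub>f indicator {k}) ks"
  unfolding family_mat_mult[OF assms] family_mat_eq_iff
proof (intro ballI)
  fix k x assume k: "k \<in> set ks"
  have "(\<Sum>l\<in>set ks. (s k *\<^sub>f indicator {k}) l *\<^sub>f c l) x = (\<Sum>l\<in>set ks. if l = k then s k * c k x else 0)"
    unfolding sum_fun_apply by (intro sum.cong) (auto simp: indicator_def)
  then show "(s k *\<^sub>f c k) x = (\<Sum>l\<in>set ks. (s k *\<^sub>f indicator {k}) l *\<^sub>f c l) x"
    using k by simp
qed

lemma ex_dual_forms:
  fixes c :: "'k \<Rightarrow> 'x \<Rightarrow> 'r :: comm_ring_1"
  assumes fin: "finite X" "finite K" "card K = card X"
    and span: "free_module X \<subseteq> fun_module.span (c ` K)"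
  shows "\<exists>\<kappa>. (\<forall>k. linear_form (\<kappa> k)) \<and> (\<forall>k\<in>K. \<forall>l\<in>K. \<kappa> k (c l) = of_bool (k = l))"
proof -
  obtain xs ks where lists: "set xs = X" "distinct xs" "set ks = K" "distinct ks"
    using fin finite_distinct_list by metis
  then have len: "length ks = length xs"
    using fin(3) by (auto simp: distinct_card)
  obtain a where "family_mat ks a xs * family_mat xs c ks = 1\<^sub>m (length xs)"
    using family_mat_inverse[of xs ks c] lists len span by metis
  then have "family_mat ks (\<lambda>l. \<Sum>x\<in>X. c l x *\<^sub>f a x) ks = family_mat ks (\<lambda>k. indicator {k}) ks"
    using lists len by (simp add: family_mat_mult family_mat_indicator)
  then have dual: "(\<Sum>x\<in>X. c l x * a x k) = indicator {l} k" if "k \<in> K" "l \<in> K" for k l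
    using that lists unfolding family_mat_eq_iff by (simp add: sum_fun_apply)
  define \<kappa> where "\<kappa> = (\<lambda>k v. \<Sum>x\<in>X. v x * a x k)"
  have "linear_form (\<kappa> k)" for k
    by (rule linear_formI) (simp_all add: \<kappa>_def sum.distrib sum_distrib_left algebra_simps)
  moreover have "\<kappa> k (c l) = of_bool (k = l)" if "k \<in> K" "l \<in> K" for k l
    using dual[OF that] by (simp add: \<kappa>_def indicator_def)
  ultimately show ?thesis by blast
qed

definition matrix_of_map :: "(('x \<Rightarrow> 'r) \<Rightarrow> 'x \<Rightarrow> 'r :: comm_ring_1) \<Rightarrow> 'x list \<Rightarrow> 'r mat" where
  "matrix_of_map T xs = family_mat xs (\<lambda>x. T (indicator {x})) xs"

lemma matrix_of_map_mult_family_mat: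
  assumes T: "linear_map T" and "distinct xs" and c: "\<And>k. k \<in> set ks \<Longrightarrow> c k \<in> free_module (set xs)"
  shows "matrix_of_map T xs * family_mat xs c ks = family_mat xs (\<lambda>k. T (c k)) ks"
proof -
  interpret T: Modules.module_hom scale_fun scale_fun T by (rule T)
  have "(\<Sum>x\<in>set xs. c k x *\<^sub>f T (indicator {x})) = T (c k)" if "k \<in> set ks" for k
    using free_module_expand[OF _ c[OF that]]
    by (metis (no_types, lifting) List.finite_set T.scale T.sum sum.cong)
  then show ?thesis
    unfolding matrix_of_map_def family_mat_mult[OF assms(2)] family_mat_eq_iff by simp
qed

lemma has_smith_normal_formI:
  assumes carrier: "M \<in> carrier_mat n n" "B \<in> carrier_mat n n" "C \<in> carrier_mat n n" "S \<in> carrier_mat n n"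
    and invertible: "invertible_mat B" "invertible_mat C"
    and MB: "M * B = C * S" and S: "diagonal_mat S" "\<And>i. Suc i < n \<Longrightarrow> S $$ (i, i) dvd S $$ (Suc i, Suc i)"
  shows "has_smith_normal_form M"
proof -
  obtain H where H: "inverts_mat C H" "inverts_mat H C"
    using invertible(2) unfolding invertible_mat_def by blast
  have H_carrier: "H \<in> carrier_mat n n"
    using H carrier(3) unfolding inverts_mat_def
    by (metis carrier_matD carrier_matI index_mult_mat(2,3) index_one_mat(2,3))
  then have "H * M * B = H * (C * S)"
    using carrier by (simp flip: MB)
  also have "\<dots> = H * C * S"
    using H_carrier carrier by (intro assoc_mult_mat[symmetric])
  also have "\<dots> = S"
    using H(2) H_carrier carrier(4) by (simp add: inverts_mat_def)
  finally have HMB: "H * M * B = S" .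
  have H_invertible: "invertible_mat H"
    using H carrier(3) H_carrier by (auto simp: invertible_mat_def)
  show ?thesis
    unfolding has_smith_normal_form_def
    by (rule exI[of _ H], rule exI[of _ B])
      (use carrier H_carrier H_invertible invertible(1) HMB S in auto)
qed

lemma has_smith_normal_form_matrix_of_map:
  fixes \<beta> \<gamma> :: "'k \<Rightarrow> 'x \<Rightarrow> 'r :: comm_ring_1" and level :: "'k \<Rightarrow> nat"
  assumes T: "linear_map T" and xs: "distinct xs" and K: "finite K" "card K = length xs"
    and \<beta>: "\<And>k. k \<in> K \<Longrightarrow> \<beta> k \<in> free_module (set xs)" "free_module (set xs) \<subseteq> fun_module.span (\<beta> ` K)"
    and \<gamma>: "free_module (set xs) \<subseteq> fun_module.span (\<gamma> ` K)"
    and T_\<beta>: "\<And>k. k \<in> K \<Longrightarrow> T (\<beta> k) = s k *\<^sub>f \<gamma> k"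
    and s: "\<And>k l. k \<in> K \<Longrightarrow> l \<in> K \<Longrightarrow> level k \<le> level l \<Longrightarrow> s k dvd s l"
  shows "has_smith_normal_form (matrix_of_map T xs)"
proof -
  obtain ks' where "set ks' = K" "distinct ks'"
    using finite_distinct_list[OF K(1)] by blast
  define ks where "ks = sort_key level ks'"
  have ks: "set ks = K" "distinct ks" "sorted (map level ks)"
    using \<open>set ks' = K\<close> \<open>distinct ks'\<close> by (auto simp: ks_def)
  have len: "length ks = length xs"
    using distinct_card[OF ks(2)] ks(1) K(2) by simp
  let ?S = "family_mat ks (\<lambda>k. s k *\<^sub>f indicator {k}) ks"
  have "matrix_of_map T xs * family_mat xs \<beta> ks = family_mat xs (\<lambda>k. T (\<beta> k)) ks"
    using T xs \<beta>(1) ks(1) by (intro matrix_of_map_mult_family_mat) auto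
  also have "\<dots> = family_mat xs (\<lambda>k. s k *\<^sub>f \<gamma> k) ks"
    unfolding family_mat_eq_iff using T_\<beta> ks(1) by simp
  also have "\<dots> = family_mat xs \<gamma> ks * ?S"
    by (rule family_mat_scale[OF ks(2)])
  finally have equivalence: "matrix_of_map T xs * family_mat xs \<beta> ks = family_mat xs \<gamma> ks * ?S" .
  show ?thesis
  proof (rule has_smith_normal_formI[OF _ _ _ _ _ _ equivalence])
    show "invertible_mat (family_mat xs \<beta> ks)" "invertible_mat (family_mat xs \<gamma> ks)"
      using xs ks len \<beta>(2) \<gamma> by (auto intro!: invertible_family_mat)
    show "diagonal_mat ?S"
      using ks(2) by (auto simp: diagonal_mat_def family_mat_def indicator_def nth_eq_iff_index_eq)
    fix i assume i: "Suc i < length xs"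
    then have "level (ks ! i) \<le> level (ks ! Suc i)"
      using sorted_nth_mono[OF ks(3), of i "Suc i"] len by simp
    then show "?S $$ (i, i) dvd ?S $$ (Suc i, Suc i)"
      using i len ks(1) s[of "ks ! i" "ks ! Suc i"] by (auto simp: family_mat_def)
  qed (use len in \<open>simp_all add: matrix_of_map_def family_mat_def\<close>)
qed

section \<open>Jordan chains\<close>

definition chain_index :: "(nat \<Rightarrow> nat) \<Rightarrow> nat \<Rightarrow> (nat \<times> nat) set" where
  "chain_index d n = (SIGMA i:{..n}. {..<d i})"

lemma mem_chain_index [simp]: "(i, j) \<in> chain_index d n \<longleftrightarrow> i \<le> n \<and> j < d i"
  by (simp add: chain_index_def)

lemma finite_chain_index: "finite (chain_index d n)"
  by (simp add: chain_index_def)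

lemma card_chain_index: "card (chain_index d n) = sum d {..n}"
  by (simp add: chain_index_def)

lemma telescoping_chain_sum:
  fixes L h f :: "nat \<Rightarrow> 'r :: comm_ring_1"
  assumes "i \<le> n" and "\<And>k. i \<le> k \<Longrightarrow> k < n \<Longrightarrow> h (Suc k) = - f k * h k"
  shows "(\<Sum>k=i..n. h k * (f k * L k + (if i < k then L (k - 1) else 0))) = h n * f n * L n"
  using assms
proof (induction n rule: dec_induct)
  case base
  then show ?case by simp
next
  case (step n)
  have "(\<Sum>k=i..Suc n. h k * (f k * L k + (if i < k then L (k - 1) else 0)))
      = h n * f n * L n + h (Suc n) * (f (Suc n) * L (Suc n) + L n)"
    using step by simp
  also have "\<dots> = h (Suc n) * f (Suc n) * L (Suc n)"
    using step.prems[of n] step.hyps by (simp add: algebra_simps)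
  finally show ?case .
qed

text \<open>
  For fixed \<open>j\<close> the vectors \<open>L (i, j)\<close> form one chain, starting at the least \<open>i\<close> with \<open>j < d i\<close> and
  ending at \<open>i = n\<close>.
\<close>

locale jordan_chains =
  fixes X :: "'x set" and T :: "('x \<Rightarrow> 'r :: comm_ring_1) \<Rightarrow> 'x \<Rightarrow> 'r"
    and L :: "nat \<times> nat \<Rightarrow> 'x \<Rightarrow> 'r" and f :: "nat \<Rightarrow> 'r"
    and d :: "nat \<Rightarrow> nat" and n :: nat
  assumes finite_X: "finite X" and card_X: "card X = sum d {..n}"
    and linear_T: "linear_map T" and mono_d: "mono d"
    and L_in: "k \<in> chain_index d n \<Longrightarrow> L k \<in> free_module X"
    and span_L: "free_module X \<subseteq> fun_module.span (L ` chain_index d n)"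
    and T_L: "i \<le> n \<Longrightarrow> j < d i \<Longrightarrow>
      T (L (i, j)) = f i *\<^sub>f L (i, j) + (if 0 < i \<and> j < d (i - 1) then L (i - 1, j) else 0)"
begin

sublocale T: Modules.module_hom scale_fun scale_fun T
  by (rule linear_T)

definition chain_start :: "nat \<Rightarrow> nat" where
  "chain_start j = (LEAST i. j < d i)"

lemma chain_start_le_iff: "j < d i \<Longrightarrow> chain_start j \<le> k \<longleftrightarrow> j < d k"
  using LeastI[of "\<lambda>i. j < d i" i] monoD[OF mono_d, of "chain_start j" k]
  by (auto simp: chain_start_def intro: Least_le)

lemma T_L_start:
  assumes "j < d n" "i = chain_start j"
  shows "T (L (i, j)) = f i *\<^sub>f L (i, j)"
proof -
  have start: "i \<le> k \<longleftrightarrow> j < d k" for k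
    using chain_start_le_iff[OF assms(1)] assms(2) by simp
  have "i \<le> n" "j < d i" "0 < i \<Longrightarrow> \<not> j < d (i - 1)"
    using assms(1) start[of n] start[of i] start[of "i - 1"] by auto
  then show ?thesis
    using T_L[of i j] by simp presburger
qed

lemma T_L_Suc:
  assumes "Suc i \<le> n" "j < d i"
  shows "T (L (Suc i, j)) = f (Suc i) *\<^sub>f L (Suc i, j) + L (i, j)"
  using assms T_L[of "Suc i" j] monoD[OF mono_d, of i "Suc i"] by simp

definition source :: "nat \<times> nat \<Rightarrow> 'x \<Rightarrow> 'r" where
  "source = (\<lambda>(i, j). if i = chain_start j then \<Sum>k=i..n. (\<Prod>l=i..<k. - f l) *\<^sub>f L (k, j) else L (i, j))"

definition target :: "nat \<times> nat \<Rightarrow> 'x \<Rightarrow> 'r" where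
  "target = (\<lambda>(i, j). if i = chain_start j then L (n, j) else T (L (i, j)))"

definition factor :: "nat \<times> nat \<Rightarrow> 'r" where
  "factor = (\<lambda>(i, j). if i = chain_start j then (\<Prod>l=i..<n. - f l) * f n else 1)"

lemma T_source:
  assumes "k \<in> chain_index d n"
  shows "T (source k) = factor k *\<^sub>f target k"
proof -
  obtain i j where k: "k = (i, j)" "i \<le> n" "j < d i" using assms by (cases k) auto
  show ?thesis
  proof (cases "i = chain_start j")
    case True
    define h where "h l = (\<Prod>m=i..<l. - f m)" for l
    have "T (source k) x
        = (\<Sum>l=i..n. h l * (f l * L (l, j) x + (if i < l then L (l - 1, j) x else 0)))" for x
    proof -
      have "T (L (l, j)) x = f l * L (l, j) x + (if i < l then L (l - 1, j) x else 0)"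
        if "i \<le> l" "l \<le> n" for l
      proof (cases "i = l")
        case True
        then show ?thesis
          using T_L_start[of j i] \<open>i = chain_start j\<close> k monoD[OF mono_d, of i n] by simp
      next
        case False
        then show ?thesis
          using T_L_Suc[of "l - 1" j] that k monoD[OF mono_d, of i "l - 1"] by (cases l) auto
      qed
      then show ?thesis
        using True by (simp add: k source_def h_def T.sum T.scale sum_fun_apply)
    qed
    also have "(\<Sum>l=i..n. h l * (f l * L (l, j) x + (if i < l then L (l - 1, j) x else 0)))
        = h n * f n * L (n, j) x" for x
      using k by (intro telescoping_chain_sum) (simp_all add: h_def prod.atLeastLessThan_Suc)
    finally show ?thesis
      using True by (simp add: fun_eq_iff k factor_def target_def h_def)
  qed (simp add: k source_def target_def factor_def)
qed

lemma source_in: "k \<in> chain_index d n \<Longrightarrow> source k \<in> free_module X"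
  using monoD[OF mono_d]
  by (cases k) (fastforce simp: source_def
      intro!: L_in fun_module.subspace_sum fun_module.subspace_scale subspace_free_module)

lemma span_source: "free_module X \<subseteq> fun_module.span (source ` chain_index d n)"
proof -
  have "L (i, j) \<in> fun_module.span (source ` chain_index d n)" if ij: "i \<le> n" "j < d i" for i j
  proof (cases "i = chain_start j")
    case True
    have inner: "L (k, j) \<in> fun_module.span (source ` chain_index d n)" if "i < k" "k \<le> n" for k
    proof -
      have "L (k, j) = source (k, j)" using that True by (simp add: source_def)
      then show ?thesis
        using that ij monoD[OF mono_d, of i k] by (intro fun_module.span_base) auto
    qed
    have "L (i, j) = source (i, j) - (\<Sum>k=Suc i..n. (\<Prod>l=i..<k. - f l) *\<^sub>f L (k, j))"
      using True ij by (simp add: source_def sum.atLeast_Suc_atMost)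
    also have "\<dots> \<in> fun_module.span (source ` chain_index d n)"
      using ij inner by (intro fun_module.span_diff fun_module.span_sum fun_module.span_scale)
        (auto intro: fun_module.span_base)
    finally show ?thesis .
  next
    case False
    then have "L (i, j) = source (i, j)" by (simp add: source_def)
    then show ?thesis using ij by (intro fun_module.span_base) auto
  qed
  then have "L ` chain_index d n \<subseteq> fun_module.span (source ` chain_index d n)" by auto
  then show ?thesis
    using span_L fun_module.span_minimal by blast
qed

lemma span_target: "free_module X \<subseteq> fun_module.span (target ` chain_index d n)"
proof -
  have "L (i, j) \<in> fun_module.span (target ` chain_index d n)" if "i \<le> n" "j < d i" for i j
    using that
  proof (induction i rule: inc_induct)
    case base
    have "target (chain_start j, j) = L (n, j)" by (simp add: target_def)
    then show ?case
      using base chain_start_le_iff[OF base]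
      by (metis fun_module.span_base imageI mem_chain_index order_refl)
  next
    case (step i)
    have "j < d (Suc i)" using step.prems monoD[OF mono_d, of i "Suc i"] by simp
    moreover have "chain_start j \<noteq> Suc i"
      using chain_start_le_iff[OF step.prems, of i] step.prems by auto
    then have "target (Suc i, j) = f (Suc i) *\<^sub>f L (Suc i, j) + L (i, j)"
      using T_L_Suc[of i j] step.hyps step.prems by (simp add: target_def)
    then have "L (i, j) = target (Suc i, j) - f (Suc i) *\<^sub>f L (Suc i, j)" by simp
    moreover have "target (Suc i, j) \<in> fun_module.span (target ` chain_index d n)"
      using calculation(1) step.hyps by (intro fun_module.span_base) simp
    ultimately show ?case
      using step.IH by (metis fun_module.span_diff fun_module.span_scale)
  qed
  then have "L ` chain_index d n \<subseteq> fun_module.span (target ` chain_index d n)" by auto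
  then show ?thesis
    using span_L fun_module.span_minimal by blast
qed

lemma has_smith_normal_form:
  assumes "distinct xs" "set xs = X"
  shows "has_smith_normal_form (matrix_of_map T xs)"
proof (rule has_smith_normal_form_matrix_of_map[where K = "chain_index d n"
      and \<beta> = source and \<gamma> = target and s = factor])
  define level where "level = (\<lambda>(i, j). if i = chain_start j then Suc n - i else 0)"
  show "factor k dvd factor l"
    if "k \<in> chain_index d n" "l \<in> chain_index d n" "level k \<le> level l" for k l
    using that by (cases k; cases l)
      (auto simp: factor_def level_def split: if_splits intro!: mult_dvd_mono prod_dvd_prod_subset)
  show "card (chain_index d n) = length xs"
    using assms card_X distinct_card by (metis card_chain_index)
qed (use assms span_source span_target source_in T_source linear_T in \<open>auto simp: finite_chain_index\<close>)

definition modulus :: "nat \<Rightarrow> 'r" where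
  "modulus j = factor (chain_start j, j)"

lemma modulus_dvd:
  assumes "i \<le> j" "j < d n"
  shows "modulus j dvd modulus i"
proof -
  have "i < d (chain_start j)"
    using chain_start_le_iff[OF assms(2), of "chain_start j"] assms(1) by simp
  then have "chain_start i \<le> chain_start j"
    by (simp add: chain_start_def Least_le)
  then show ?thesis
    by (auto simp: modulus_def factor_def intro!: mult_dvd_mono prod_dvd_prod_subset)
qed

lemma ex_target_coefficient_forms:
  obtains \<kappa> where "\<And>k. linear_form (\<kappa> k)"
    "\<And>k a. k \<in> chain_index d n \<Longrightarrow> \<kappa> k (\<Sum>l\<in>chain_index d n. a l *\<^sub>f target l) = a k"
proof -
  let ?K = "chain_index d n"
  have "card ?K = card X" by (simp add: card_chain_index card_X)
  then obtain \<kappa> where \<kappa>: "\<And>k. linear_form (\<kappa> k)"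
    and dual: "\<And>k l. k \<in> ?K \<Longrightarrow> l \<in> ?K \<Longrightarrow> \<kappa> k (target l) = of_bool (k = l)"
    using ex_dual_forms[OF finite_X finite_chain_index _ span_target] by blast
  have "\<kappa> k (\<Sum>l\<in>?K. a l *\<^sub>f target l) = a k" if "k \<in> ?K" for k a
  proof -
    interpret \<kappa>: Modules.module_hom scale_fun "(*)" "\<kappa> k" by (rule \<kappa>)
    have "\<kappa> k (\<Sum>l\<in>?K. a l *\<^sub>f target l) = (\<Sum>l\<in>?K. if k = l then a l else 0)"
      unfolding \<kappa>.sum \<kappa>.scale using dual[OF that] by (intro sum.cong) auto
    then show ?thesis
      using that by (simp add: finite_chain_index)
  qed
  with \<kappa> show ?thesis by (rule that)
qed

lemma sum_target_in_image_iff: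
  assumes "v = (\<Sum>k\<in>chain_index d n. a k *\<^sub>f target k)"
  shows "v \<in> T ` free_module X \<longleftrightarrow> (\<forall>k\<in>chain_index d n. factor k dvd a k)"
proof -
  let ?K = "chain_index d n"
  have T_sum: "T (\<Sum>k\<in>?K. b k *\<^sub>f source k) = (\<Sum>k\<in>?K. (factor k * b k) *\<^sub>f target k)" for b
    by (simp add: T.sum T.scale T_source mult.commute)
  show ?thesis
  proof
    assume "v \<in> T ` free_module X"
    then obtain w where w: "w \<in> free_module X" "v = T w" by blast
    obtain b where "w = (\<Sum>k\<in>?K. b k *\<^sub>f source k)"
      using subsetD[OF span_source w(1)] finite_chain_index by (rule fun_module.span_imageE)
    then have v: "v = (\<Sum>k\<in>?K. (factor k * b k) *\<^sub>f target k)"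
      using w(2) T_sum by simp
    obtain \<kappa> where "\<And>k. linear_form (\<kappa> k)"
      and "\<And>k a. k \<in> ?K \<Longrightarrow> \<kappa> k (\<Sum>l\<in>?K. a l *\<^sub>f target l) = a k"
      using ex_target_coefficient_forms by blast
    then have "a k = factor k * b k" if "k \<in> ?K" for k
      using that assms v by metis
    then show "\<forall>k\<in>?K. factor k dvd a k" by simp
  next
    assume "\<forall>k\<in>?K. factor k dvd a k"
    then have "\<forall>k\<in>?K. \<exists>q. a k = factor k * q" unfolding dvd_def by blast
    from bchoice[OF this] obtain b where b: "\<And>k. k \<in> ?K \<Longrightarrow> a k = factor k * b k" by blast
    then have "v = T (\<Sum>k\<in>?K. b k *\<^sub>f source k)"
      unfolding assms T_sum by simp
    moreover have "(\<Sum>k\<in>?K. b k *\<^sub>f source k) \<in> free_module X"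
      using source_in by (intro fun_module.subspace_sum fun_module.subspace_scale subspace_free_module)
    ultimately show "v \<in> T ` free_module X" by blast
  qed
qed

lemma ex_cokernel_forms:
  obtains \<phi> where "\<And>j. linear_form (\<phi> j)"
    "\<And>i j. i < d n \<Longrightarrow> j < d n \<Longrightarrow> \<phi> j (L (n, i)) = of_bool (j = i)"
    "\<And>v. v \<in> free_module X \<Longrightarrow> v \<in> T ` free_module X \<longleftrightarrow> (\<forall>j<d n. modulus j dvd \<phi> j v)"
proof -
  let ?K = "chain_index d n"
  obtain \<kappa> where \<kappa>: "\<And>k. linear_form (\<kappa> k)"
    and coefficient: "\<And>k a. k \<in> ?K \<Longrightarrow> \<kappa> k (\<Sum>l\<in>?K. a l *\<^sub>f target l) = a k"
    using ex_target_coefficient_forms by blast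
  have start_in: "(chain_start j, j) \<in> ?K" if "j < d n" for j
    using chain_start_le_iff[OF that, of n] chain_start_le_iff[OF that, of "chain_start j"] that by simp
  show ?thesis
  proof (rule that[of "\<lambda>j. \<kappa> (chain_start j, j)"])
    show "linear_form (\<kappa> (chain_start j, j))" for j by (rule \<kappa>)
    show "\<kappa> (chain_start j, j) (L (n, i)) = of_bool (j = i)" if ij: "i < d n" "j < d n" for i j
    proof -
      have "L (n, i) = (\<Sum>l\<in>?K. if l = (chain_start i, i) then target l else 0)"
        using start_in[OF ij(1)] by (simp add: finite_chain_index target_def)
      also have "\<dots> = (\<Sum>l\<in>?K. of_bool (l = (chain_start i, i)) *\<^sub>f target l)"
        by (intro sum.cong) auto
      finally show ?thesis
        using coefficient[OF start_in[OF ij(2)]] by auto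
    qed
    fix v :: "'x \<Rightarrow> 'r"
    assume "v \<in> free_module X"
    from subsetD[OF span_target this] finite_chain_index
    obtain a where a: "v = (\<Sum>k\<in>?K. a k *\<^sub>f target k)"
      by (rule fun_module.span_imageE)
    have "(\<forall>k\<in>?K. factor k dvd a k) \<longleftrightarrow> (\<forall>j<d n. modulus j dvd a (chain_start j, j))"
    proof (intro iffI ballI allI impI)
      show "modulus j dvd a (chain_start j, j)" if "\<forall>k\<in>?K. factor k dvd a k" "j < d n" for j
        using that start_in by (simp add: modulus_def)
      show "factor k dvd a k" if "\<forall>j<d n. modulus j dvd a (chain_start j, j)" "k \<in> ?K" for k
        using that monoD[OF mono_d, of "fst k" n] by (cases k) (auto simp: modulus_def factor_def)
    qed
    then show "v \<in> T ` free_module X \<longleftrightarrow> (\<forall>j<d n. modulus j dvd \<kappa> (chain_start j, j) v)"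
      unfolding sum_target_in_image_iff[OF a] using coefficient start_in by (simp add: a)
  qed
qed

end

section \<open>Graded posets and their up and down operators\<close>

locale locally_finite_poset =
  fixes S :: "'a set" and leq :: "'a \<Rightarrow> 'a \<Rightarrow> bool"
  assumes partial_order: "partial_order_on' S leq" and locally_finite: "locally_finite S leq"
begin

lemma refl: "x \<in> S \<Longrightarrow> leq x x"
  using partial_order by (simp add: partial_order_on'_def)

lemma antisym: "x \<in> S \<Longrightarrow> y \<in> S \<Longrightarrow> leq x y \<Longrightarrow> leq y x \<Longrightarrow> x = y"
  using partial_order unfolding partial_order_on'_def by blast

lemma trans: "x \<in> S \<Longrightarrow> y \<in> S \<Longrightarrow> z \<in> S \<Longrightarrow> leq x y \<Longrightarrow> leq y z \<Longrightarrow> leq x z"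
  using partial_order unfolding partial_order_on'_def by blast

lemma ex_covby_below:
  assumes x: "x \<in> S" and y: "y \<in> S" "leq y x" "y \<noteq> x"
  shows "\<exists>z. covby S leq z x"
proof -
  define I where "I = {z \<in> S. leq y z \<and> leq z x} - {x}"
  have "finite I" "I \<noteq> {}"
    using locally_finite x y refl by (auto simp: I_def locally_finite_def)
  moreover have "asymp_on I (\<lambda>a b. leq a b \<and> a \<noteq> b)"
    by (rule asymp_onI) (auto simp: I_def dest: antisym)
  moreover have "transp_on I (\<lambda>a b. leq a b \<and> a \<noteq> b)"
    by (rule transp_onI) (auto simp: I_def intro: trans dest: antisym)
  ultimately obtain z where z: "z \<in> I" "\<And>w. w \<in> I \<Longrightarrow> w \<noteq> z \<Longrightarrow> \<not> leq z w"
    using Finite_Set.bex_max_element[of I "\<lambda>a b. leq a b \<and> a \<noteq> b"] by metis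
  have "w = z \<or> w = x" if "w \<in> S" "leq z w" "leq w x" for w
    using that z trans[of y z w] y by (auto simp: I_def)
  then have "covby S leq z x"
    using z(1) x by (auto simp: covby_def I_def)
  then show ?thesis ..
qed

lemma rank_fun_unique:
  assumes rk: "is_rank_fun S leq rk" "is_rank_fun S leq rk'" and "x \<in> S"
  shows "rk x = rk' x"
  using \<open>x \<in> S\<close>
proof (induction "rk x" arbitrary: x rule: less_induct)
  case less
  show ?case
  proof (cases "\<exists>y. covby S leq y x")
    case True
    then obtain y where y: "covby S leq y x" ..
    then have "y \<in> S" "rk x = rk y + 1" "rk' x = rk' y + 1"
      using rk by (auto simp: is_rank_fun_def covby_def)
    then show ?thesis using less.hyps[of y] by simp
  next
    case False
    then have "\<forall>y\<in>S. leq y x \<longrightarrow> y = x" using ex_covby_below less.prems by blast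
    then show ?thesis using rk less.prems by (simp add: is_rank_fun_def)
  qed
qed

end

definition up :: "'a set \<Rightarrow> ('a \<Rightarrow> 'a \<Rightarrow> bool) \<Rightarrow> ('a \<Rightarrow> 'r :: comm_monoid_add) \<Rightarrow> 'a \<Rightarrow> 'r" where
  "up S leq f x = (\<Sum>y | covby S leq y x. f y)"

definition down :: "'a set \<Rightarrow> ('a \<Rightarrow> 'a \<Rightarrow> bool) \<Rightarrow> ('a \<Rightarrow> 'r :: comm_monoid_add) \<Rightarrow> 'a \<Rightarrow> 'r" where
  "down S leq f x = (\<Sum>y | covby S leq x y. f y)"

lemma linear_map_up: "linear_map (up S leq)"
  by (rule linear_mapI) (auto simp: up_def sum.distrib sum_distrib_left)

lemma linear_map_down: "linear_map (down S leq)"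
  by (rule linear_mapI) (auto simp: down_def sum.distrib sum_distrib_left)

lemma up_of_int: "up S leq (\<lambda>x. of_int (f x)) = (\<lambda>x. of_int (up S leq f x))"
  by (simp add: up_def fun_eq_iff)

lemma down_of_int: "down S leq (\<lambda>x. of_int (f x)) = (\<lambda>x. of_int (down S leq f x))"
  by (simp add: down_def fun_eq_iff)

lemma up_in_free_module: "up S leq f \<in> free_module S"
  by (auto simp: free_module_def up_def covby_def)

lemma down_in_free_module: "down S leq f \<in> free_module S"
  by (auto simp: free_module_def down_def covby_def)

locale graded_poset = locally_finite_poset +
  assumes graded: "graded S leq" and finite_rank_set: "finite (rank_set S leq n)"
    and unique_min: "has_unique_min S leq"
begin

abbreviation "rank \<equiv> rank_of S leq"
abbreviation "P \<equiv> rank_set S leq"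
abbreviation "V n \<equiv> free_module (P n)"
abbreviation "U \<equiv> up S leq"
abbreviation "D \<equiv> down S leq"

sublocale U: Modules.module_hom scale_fun scale_fun U
  by (rule linear_map_up)

sublocale D: Modules.module_hom scale_fun scale_fun D
  by (rule linear_map_down)

lemma rank_fun: "is_rank_fun S leq rank"
  using graded unfolding graded_def rank_of_def by (rule someI_ex)

lemma rank_covby: "covby S leq x y \<Longrightarrow> rank y = Suc (rank x)"
  using rank_fun by (simp add: is_rank_fun_def)

lemma covby_in: "covby S leq x y \<Longrightarrow> x \<in> S" "covby S leq x y \<Longrightarrow> y \<in> S"
  by (simp_all add: covby_def)

lemma in_rank_set_iff: "x \<in> P n \<longleftrightarrow> x \<in> S \<and> rank x = n"
  by (simp add: rank_set_def)

lemma covers_below_eq: "x \<in> P (Suc n) \<Longrightarrow> {y. covby S leq y x} = {y \<in> P n. covby S leq y x}"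
  by (auto simp: in_rank_set_iff covby_in dest: rank_covby)

lemma covers_above_eq: "x \<in> P n \<Longrightarrow> {y. covby S leq x y} = {y \<in> P (Suc n). covby S leq x y}"
  by (auto simp: in_rank_set_iff covby_in dest: rank_covby)

lemma finite_covers_above: "finite {y. covby S leq x y}"
  by (rule finite_subset[OF _ finite_rank_set[of "Suc (rank x)"]])
    (auto simp: in_rank_set_iff covby_in rank_covby)

lemma finite_covers_below: "finite {y. covby S leq y x}"
  by (rule finite_subset[OF _ finite_rank_set[of "rank x - 1"]])
    (auto simp: in_rank_set_iff covby_in rank_covby)

lemma free_module_rank_subset: "V n \<subseteq> free_module S"
  by (auto simp: free_module_def in_rank_set_iff)

lemma up_in: "f \<in> V n \<Longrightarrow> U f \<in> V (Suc n)"
  unfolding free_module_def up_def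
  by (clarsimp intro!: sum.neutral) (metis in_rank_set_iff covby_in rank_covby)

lemma down_in: "f \<in> V (Suc n) \<Longrightarrow> D f \<in> V n"
  unfolding free_module_def down_def
  by (clarsimp intro!: sum.neutral) (metis in_rank_set_iff covby_in rank_covby nat.inject)

lemma down_eq_0: "f \<in> V 0 \<Longrightarrow> D f = 0"
  by (auto simp: free_module_def down_def fun_eq_iff in_rank_set_iff dest: rank_covby intro!: sum.neutral)

lemma up_eq_0: "x \<in> P 0 \<Longrightarrow> U f x = 0"
  by (auto simp: up_def in_rank_set_iff dest: rank_covby intro!: sum.neutral)

lemma up_down_adjoint:
  fixes f g :: "'a \<Rightarrow> 'r :: comm_ring_1"
  shows "(\<Sum>x\<in>P (Suc n). U f x * g x) = (\<Sum>y\<in>P n. f y * D g y)"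
proof -
  have "(\<Sum>x\<in>P (Suc n). U f x * g x) = (\<Sum>x\<in>P (Suc n). \<Sum>y\<in>{y \<in> P n. covby S leq y x}. f y * g x)"
    by (simp add: up_def covers_below_eq sum_distrib_right)
  also have "\<dots> = (\<Sum>y\<in>P n. \<Sum>x\<in>{x \<in> P (Suc n). covby S leq y x}. f y * g x)"
    by (intro sum.swap_restrict finite_rank_set)
  also have "\<dots> = (\<Sum>y\<in>P n. f y * D g y)"
    by (simp add: down_def covers_above_eq sum_distrib_left)
  finally show ?thesis .
qed

lemma down_up_eq_sum:
  fixes f :: "'a \<Rightarrow> 'r :: comm_ring_1"
  assumes "x \<in> S"
  shows "D (U f) x = (\<Sum>v\<in>P (rank x). of_nat (card {z \<in> S. covby S leq x z \<and> covby S leq v z}) * f v)"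
proof -
  have sets: "{z. covby S leq x z \<and> covby S leq v z} = {z \<in> S. covby S leq x z \<and> covby S leq v z}" for v
    by (auto simp: covby_in)
  have "{v. covby S leq v z} = {v \<in> P (rank x). covby S leq v z}" if "covby S leq x z" for z
    using that by (intro covers_below_eq) (simp add: in_rank_set_iff covby_in rank_covby)
  then have "D (U f) x = (\<Sum>z\<in>{z. covby S leq x z}. \<Sum>v\<in>{v \<in> P (rank x). covby S leq v z}. f v)"
    by (simp add: down_def up_def)
  also have "\<dots> = (\<Sum>v\<in>P (rank x). \<Sum>z\<in>{z \<in> {z. covby S leq x z}. covby S leq v z}. f v)"
    by (intro sum.swap_restrict finite_rank_set finite_covers_above)
  also have "\<dots> = (\<Sum>v\<in>P (rank x). of_nat (card {z. covby S leq x z \<and> covby S leq v z}) * f v)"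
    by simp
  finally show ?thesis
    by (simp only: sets)
qed

lemma up_down_eq_sum:
  fixes f :: "'a \<Rightarrow> 'r :: comm_ring_1"
  assumes "x \<in> S"
  shows "U (D f) x = (\<Sum>v\<in>P (rank x). of_nat (card {z \<in> S. covby S leq z x \<and> covby S leq z v}) * f v)"
proof -
  have sets: "{z. covby S leq z x \<and> covby S leq z v} = {z \<in> S. covby S leq z x \<and> covby S leq z v}" for v
    by (auto simp: covby_in)
  have "{v. covby S leq z v} = {v \<in> P (rank x). covby S leq z v}" if "covby S leq z x" for z
    using that covers_above_eq[of z "rank z"] by (simp add: in_rank_set_iff covby_in rank_covby)
  then have "U (D f) x = (\<Sum>z\<in>{z. covby S leq z x}. \<Sum>v\<in>{v \<in> P (rank x). covby S leq z v}. f v)"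
    by (simp add: down_def up_def)
  also have "\<dots> = (\<Sum>v\<in>P (rank x). \<Sum>z\<in>{z \<in> {z. covby S leq z x}. covby S leq z v}. f v)"
    by (intro sum.swap_restrict finite_rank_set finite_covers_below)
  also have "\<dots> = (\<Sum>v\<in>P (rank x). of_nat (card {z. covby S leq z x \<and> covby S leq z v}) * f v)"
    by simp
  finally show ?thesis
    by (simp only: sets)
qed

lemma down_up_indicator:
  assumes "u \<in> S" "v \<in> S"
  shows "D (U (indicator {v})) u
    = (of_nat (card {z \<in> S. covby S leq u z \<and> covby S leq v z}) :: 'r :: comm_ring_1)"
proof (cases "rank v = rank u")
  case True
  have "D (U (indicator {v})) u
      = (\<Sum>w\<in>P (rank u). if w = v then of_nat (card {z \<in> S. covby S leq u z \<and> covby S leq v z}) else 0 :: 'r)"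
    unfolding down_up_eq_sum[OF assms(1)] by (intro sum.cong) (auto simp: indicator_def)
  then show ?thesis
    using True assms(2) finite_rank_set by (simp add: in_rank_set_iff)
next
  case False
  then have empty: "{z \<in> S. covby S leq u z \<and> covby S leq v z} = {}"
    by (auto dest!: rank_covby)
  show ?thesis
    unfolding empty down_up_eq_sum[OF assms(1)] using False
    by (auto simp: indicator_def in_rank_set_iff intro!: sum.neutral)
qed

lemma up_down_indicator:
  assumes "u \<in> S" "v \<in> S"
  shows "U (D (indicator {v})) u
    = (of_nat (card {z \<in> S. covby S leq z u \<and> covby S leq z v}) :: 'r :: comm_ring_1)"
proof (cases "rank v = rank u")
  case True
  have "U (D (indicator {v})) u
      = (\<Sum>w\<in>P (rank u). if w = v then of_nat (card {z \<in> S. covby S leq z u \<and> covby S leq z v}) else 0 :: 'r)"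
    unfolding up_down_eq_sum[OF assms(1)] by (intro sum.cong) (auto simp: indicator_def)
  then show ?thesis
    using True assms(2) finite_rank_set by (simp add: in_rank_set_iff)
next
  case False
  then have empty: "{z \<in> S. covby S leq z u \<and> covby S leq z v} = {}"
    using rank_covby by fastforce
  show ?thesis
    unfolding empty up_down_eq_sum[OF assms(1)] using False
    by (auto simp: indicator_def in_rank_set_iff intro!: sum.neutral)
qed

lemma down_up_commutator:
  fixes f :: "'a \<Rightarrow> 'r :: comm_ring_1"
  assumes "differential S leq r" "x \<in> S"
  shows "D (U f) x = U (D f) x + of_nat r * f x"
proof -
  have "card {z \<in> S. covby S leq x z \<and> covby S leq v z}
      = card {z \<in> S. covby S leq z x \<and> covby S leq z v} + (if v = x then r else 0)" if "v \<in> S" for v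
    using assms that by (cases "v = x") (auto simp: differential_def)
  then have "D (U f) x = (\<Sum>v\<in>P (rank x). of_nat (card {z \<in> S. covby S leq z x \<and> covby S leq z v}) * f v
      + (if v = x then of_nat r * f x else 0))"
    unfolding down_up_eq_sum[OF assms(2)] by (intro sum.cong) (auto simp: in_rank_set_iff algebra_simps)
  then show ?thesis
    using assms(2) finite_rank_set by (simp add: sum.distrib up_down_eq_sum in_rank_set_iff)
qed

lemma differentialI_commutator:
  assumes "0 < r" and commutator: "\<And>(f :: 'a \<Rightarrow> int) x. x \<in> S \<Longrightarrow> D (U f) x = U (D f) x + int r * f x"
  shows "differential S leq r"
proof -
  have common_covers: "card {z \<in> S. covby S leq u z \<and> covby S leq v z}
      = card {z \<in> S. covby S leq z u \<and> covby S leq z v} + (if u = v then r else 0)"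
    if "u \<in> S" "v \<in> S" for u v
    using commutator[OF that(1), of "indicator {v}"]
    by (auto simp: down_up_indicator up_down_indicator that indicator_def split: if_splits)
  moreover have "card {z \<in> S. covby S leq x z} = card {z \<in> S. covby S leq z x} + r" if "x \<in> S" for x
    using common_covers[OF that that] by simp
  ultimately show ?thesis
    using assms(1) partial_order graded locally_finite finite_rank_set unique_min
    by (simp add: differential_def)
qed

lemma ex_rank_set_0: "\<exists>m. P 0 = {m}"
proof -
  obtain m where m: "m \<in> S" "\<And>x. x \<in> S \<Longrightarrow> leq m x"
    using unique_min by (auto simp: has_unique_min_def)
  have "rank m = 0"
    using rank_fun m antisym by (auto simp: is_rank_fun_def)
  moreover have "x = m" if "x \<in> S" "rank x = 0" for x
    using ex_covby_below[OF that(1) m(1)] m(2)[OF that(1)] that(2)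
    by (metis rank_covby nat.distinct(1))
  ultimately have "P 0 = {m}"
    using m(1) unfolding set_eq_iff in_rank_set_iff by blast
  then show ?thesis ..
qed

lemma rank_size_0: "rank_size S leq 0 = 1"
  using ex_rank_set_0 by (auto simp: rank_size_def)

lemma rank_set_Suc: "P (Suc n) = (\<Union>y\<in>P n. {z \<in> S. covby S leq y z})"
proof (intro equalityI subsetI)
  fix x assume x: "x \<in> P (Suc n)"
  obtain y where y: "covby S leq y x"
  proof (rule ccontr)
    assume "\<not> thesis"
    then have "\<nexists>y. covby S leq y x" using that by blast
    then have "\<forall>y\<in>S. leq y x \<longrightarrow> y = x"
      using ex_covby_below x by (auto simp: in_rank_set_iff)
    then have "rank x = 0"
      using rank_fun x unfolding is_rank_fun_def in_rank_set_iff by blast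
    then show False using x by (simp add: in_rank_set_iff)
  qed
  then have "y \<in> P n"
    using x rank_covby[OF y] by (simp add: in_rank_set_iff covby_in)
  then show "x \<in> (\<Union>y\<in>P n. {z \<in> S. covby S leq y z})"
    using y covby_in by blast
qed (auto simp: in_rank_set_iff covby_in rank_covby)

lemma down_maps_surjective_iff:
  "down_maps_surjective S leq \<longleftrightarrow> (\<forall>g :: 'a \<Rightarrow> int. \<exists>f. \<forall>x\<in>S. D f x = g x)"
proof -
  have D_eq: "(\<Sum>x\<in>P (Suc n). if covby S leq y x then f x else 0) = D f y"
    if "y \<in> P n" for y n and f :: "'a \<Rightarrow> int"
    using that finite_rank_set by (simp add: down_def covers_above_eq sum.inter_filter)
  show ?thesis
  proof (intro iffI allI)
    fix g :: "'a \<Rightarrow> int"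
    assume "down_maps_surjective S leq"
    then have "\<exists>f. \<forall>y\<in>P n. D f y = g y" for n
      unfolding down_maps_surjective_def using D_eq[of _ n] by (metis diff_Suc_1 le_add1 plus_1_eq_Suc)
    then obtain F where F: "\<And>n y. y \<in> P n \<Longrightarrow> D (F n) y = g y"
      by metis
    have "D (\<lambda>x. F (rank x - 1) x) y = g y" if "y \<in> S" for y
    proof -
      have "D (\<lambda>x. F (rank x - 1) x) y = D (F (rank y)) y"
        unfolding down_def by (intro sum.cong) (auto dest: rank_covby)
      then show ?thesis using F[of y "rank y"] that by (simp add: in_rank_set_iff)
    qed
    then show "\<exists>f. \<forall>x\<in>S. D f x = g x" by blast
  next
    assume surj: "\<forall>g :: 'a \<Rightarrow> int. \<exists>f. \<forall>x\<in>S. D f x = g x"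
    show "down_maps_surjective S leq"
      unfolding down_maps_surjective_def
    proof (intro allI impI)
      fix n :: nat and g :: "'a \<Rightarrow> int"
      assume "1 \<le> n"
      then obtain m where n: "n = Suc m" by (cases n) auto
      obtain f where "\<forall>x\<in>S. D f x = g x" using surj by blast
      then have "\<forall>y\<in>P m. D f y = g y" by (simp add: in_rank_set_iff)
      then show "\<exists>f. \<forall>y\<in>P (n - 1). (\<Sum>x\<in>P n. if covby S leq y x then f x else 0) = g y"
        using D_eq[of _ m f] by (auto simp: n)
    qed
  qed
qed

end

section \<open>Differential posets\<close>

locale differential_poset =
  fixes S :: "'a set" and leq :: "'a \<Rightarrow> 'a \<Rightarrow> bool" and r :: nat
  assumes differential: "differential S leq r"
begin

sublocale graded_poset S leq
  using differential by unfold_locales (simp_all add: differential_def)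

lemma r_pos: "0 < r"
  using differential by (simp add: differential_def)

lemma down_up:
  assumes "f \<in> free_module S"
  shows "D (U f) = U (D f) + of_nat r *\<^sub>f f"
proof
  fix x
  show "D (U f) x = (U (D f) + of_nat r *\<^sub>f f) x"
  proof (cases "x \<in> S")
    case True
    then show ?thesis by (simp add: down_up_commutator[OF differential])
  next
    case False
    then show ?thesis
      using assms up_in_free_module[of S leq "D f"] down_in_free_module[of S leq "U f"]
      by (simp add: free_module_def)
  qed
qed

text \<open>\<open>D U = U D + r\<close> is positive definite, as \<open>U\<close> is the transpose of \<open>D\<close>.\<close>

lemma up_injective:
  fixes f :: "'a \<Rightarrow> 'r :: linordered_idom"
  assumes f: "f \<in> V n" and zero: "U f = 0"
  shows "f = 0"
proof -
  have "0 \<le> (\<Sum>y\<in>P n. f y * U (D f) y)"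
  proof (cases n)
    case 0
    then show ?thesis by (simp add: up_eq_0)
  next
    case (Suc m)
    have "(\<Sum>y\<in>P n. f y * U (D f) y) = (\<Sum>z\<in>P m. D f z * D f z)"
      using up_down_adjoint[where n = m and f = "D f" and g = f] by (simp add: Suc mult.commute)
    then show ?thesis by (simp add: sum_nonneg)
  qed
  moreover have "D (U f) = U (D f) + of_nat r *\<^sub>f f"
    using f free_module_rank_subset by (intro down_up) blast
  then have "(\<Sum>y\<in>P n. f y * D (U f) y) = (\<Sum>y\<in>P n. f y * U (D f) y) + of_nat r * (\<Sum>y\<in>P n. f y * f y)"
    by (simp add: distrib_left sum.distrib sum_distrib_left mult.left_commute)
  then have "0 = (\<Sum>y\<in>P n. f y * U (D f) y) + of_nat r * (\<Sum>y\<in>P n. f y * f y)"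
    by (simp add: zero)
  ultimately have "of_nat r * (\<Sum>y\<in>P n. f y * f y) \<le> 0"
    by linarith
  then have "(\<Sum>y\<in>P n. f y * f y) = 0"
    using r_pos by (simp add: mult_le_0_iff sum_nonneg order_antisym)
  then have "\<forall>y\<in>P n. f y = 0"
    using finite_rank_set by (simp add: sum_nonneg_eq_0_iff)
  then show ?thesis
    using f by (auto simp: free_module_def fun_eq_iff)
qed

lemma rank_size_mono: "rank_size S leq n \<le> rank_size S leq (Suc n)"
  unfolding rank_size_def
proof (rule card_le_of_injective_linear_map)
  show "linear_map (U :: ('a \<Rightarrow> real) \<Rightarrow> 'a \<Rightarrow> real)" by (rule linear_map_up)
qed (auto intro: finite_rank_set up_in up_injective)

lemma card_covers: "x \<in> S \<Longrightarrow> card {z \<in> S. covby S leq x z} = card {z \<in> S. covby S leq z x} + r"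
  using differential by (simp add: differential_def)

lemma rank_size_pos: "0 < rank_size S leq n"
proof (induction n)
  case (Suc n)
  then show ?case using rank_size_mono[of n] by simp
qed (simp add: rank_size_0)

lemma rank_size_1: "rank_size S leq 1 = r"
proof -
  obtain m where m: "P 0 = {m}" using ex_rank_set_0 ..
  then have "m \<in> S" "rank m = 0"
    using in_rank_set_iff[of m 0] by auto
  moreover from this have "{z \<in> S. covby S leq z m} = {}"
    by (auto dest: rank_covby)
  ultimately have "card {z \<in> S. covby S leq m z} = r"
    using card_covers[of m] by (simp only: card.empty add_0)
  then show ?thesis
    by (simp add: rank_size_def rank_set_Suc m)
qed

lemma rank_size_2:
  assumes "r = 1"
  shows "rank_size S leq 2 = 2"
proof -
  obtain m a where m: "P 0 = {m}" and a: "P 1 = {a}"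
    using ex_rank_set_0 rank_size_1 assms by (auto simp: rank_size_def card_1_singleton_iff)
  then have "a \<in> S" "covby S leq m a"
    using rank_set_Suc[of 0] by (auto simp: rank_set_def)
  moreover have "rank a = 1"
    using a in_rank_set_iff[of a 1] by auto
  then have "z = m" if "covby S leq z a" for z
    using m in_rank_set_iff[of z 0] rank_covby[OF that] covby_in(1)[OF that] by simp
  ultimately have "{z \<in> S. covby S leq z a} = {m}"
    using covby_in(1) by blast
  then show ?thesis
    using \<open>a \<in> S\<close> card_covers[of a] rank_set_Suc[of 1] a assms by (simp add: rank_size_def numeral_2_eq_2)
qed

end

section \<open>Bases adapted to the up and down operators\<close>

context differential_poset
begin

lemma up_funpow_in: "f \<in> V i \<Longrightarrow> (U ^^ k) f \<in> V (i + k)"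
  by (induction k) (simp_all add: up_in)

lemma up_funpow_0: "(U ^^ k) (0 :: 'a \<Rightarrow> 'r :: comm_ring_1) = 0"
  by (induction k) (simp_all only: funpow.simps comp_apply id_apply U.zero)

lemma down_up_funpow:
  assumes "f \<in> free_module S"
  shows "D ((U ^^ Suc k) f) = (U ^^ Suc k) (D f) + of_nat (Suc k * r) *\<^sub>f (U ^^ k) f"
proof (induction k)
  case 0
  then show ?case using down_up[OF assms] by simp
next
  case (Suc k)
  have "D (U ((U ^^ Suc k) f)) = U (D ((U ^^ Suc k) f)) + of_nat r *\<^sub>f (U ^^ Suc k) f"
    by (intro down_up) (simp add: up_in_free_module)
  also have "\<dots> = U ((U ^^ Suc k) (D f))
      + (of_nat (Suc k * r) *\<^sub>f U ((U ^^ k) f) + of_nat r *\<^sub>f (U ^^ Suc k) f)"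
    unfolding Suc.IH by (simp add: U.add U.scale add.assoc)
  also have "of_nat (Suc k * r) *\<^sub>f U ((U ^^ k) f) + of_nat r *\<^sub>f (U ^^ Suc k) f
      = of_nat (Suc (Suc k) * r) *\<^sub>f (U ^^ Suc k) f"
    by (simp add: fun_eq_iff algebra_simps)
  finally show ?case by simp
qed

end

locale convex_differential_poset = differential_poset +
  assumes surjective: "down_maps_surjective S leq" and two_le_r: "2 \<le> r"
    and convex: "2 * rank_size S leq (Suc n) < rank_size S leq n + rank_size S leq (Suc (Suc n))"
begin

definition rank_diff :: "nat \<Rightarrow> nat" where
  "rank_diff n = (case n of 0 \<Rightarrow> 1 | Suc m \<Rightarrow> rank_size S leq (Suc m) - rank_size S leq m)"

lemma card_rank_set: "card (P n) = sum rank_diff {..n}"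
proof (induction n)
  case 0
  then show ?case using rank_size_0 by (simp add: rank_diff_def rank_size_def)
next
  case (Suc n)
  then show ?case using rank_size_mono[of n] by (simp add: rank_diff_def rank_size_def)
qed

lemma rank_diff_growth: "rank_diff n < rank_diff (Suc n) \<or> n = 0 \<and> r = 2 \<and> rank_diff (Suc n) = rank_diff n"
proof (cases n)
  case 0
  then show ?thesis using rank_size_0 rank_size_1 two_le_r by (auto simp: rank_diff_def)
next
  case (Suc m)
  then show ?thesis using convex[of m] rank_size_mono[of m] by (simp add: rank_diff_def)
qed

lemma mono_rank_diff: "mono rank_diff"
  using rank_diff_growth by (intro mono_iff_le_Suc[THEN iffD2]) (metis less_imp_le order_refl)

lemma ex_down_preimage:
  fixes g :: "'a \<Rightarrow> int"
  assumes g: "g \<in> V n"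
  obtains f where "f \<in> V (Suc n)" "D f = g"
proof -
  obtain f where f: "\<And>x. x \<in> S \<Longrightarrow> D f x = g x"
    using surjective unfolding down_maps_surjective_iff by blast
  define f' where "f' x = (if x \<in> P (Suc n) then f x else 0)" for x
  have f'_in: "f' \<in> V (Suc n)"
    by (simp add: f'_def free_module_def)
  moreover have "D f' = g"
  proof
    fix x
    show "D f' x = g x"
    proof (cases "x \<in> P n")
      case True
      then have "D f' x = D f x"
        by (simp add: down_def covers_above_eq f'_def)
      then show ?thesis using True f by (simp add: in_rank_set_iff)
    next
      case False
      then show ?thesis using g down_in[OF f'_in] by (simp add: free_module_def)
    qed
  qed
  ultimately show ?thesis by (rule that)
qed

definition up_complement :: "nat \<Rightarrow> (nat \<Rightarrow> 'a \<Rightarrow> int) \<Rightarrow> bool" where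
  "up_complement n c \<longleftrightarrow>
     fun_module.span (U ` V n \<union> c ` {..<rank_diff (Suc n)}) = V (Suc n)"

lemma up_complement_in: "up_complement n c \<Longrightarrow> k < rank_diff (Suc n) \<Longrightarrow> c k \<in> V (Suc n)"
  unfolding up_complement_def by (metis UnI2 fun_module.span_base imageI lessThan_iff)

lemma up_complement_decompose:
  assumes "up_complement n c" "v \<in> V (Suc n)"
  obtains u w where "u \<in> V n" "w \<in> fun_module.span (c ` {..<rank_diff (Suc n)})" "v = U u + w"
proof -
  have span_U: "fun_module.span (U ` V n) = U ` V n"
    by (simp add: U.subspace_image subspace_free_module)
  show ?thesis
    using assms that unfolding up_complement_def fun_module.span_Un span_U by blast
qed

lemma up_complement_cong:
  assumes "up_complement n c"
    and "fun_module.span (c' ` {..<rank_diff (Suc n)}) = fun_module.span (c ` {..<rank_diff (Suc n)})"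
  shows "up_complement n c'"
  using assms by (simp add: up_complement_def fun_module.span_Un)

lemma up_complement_shift:
  assumes c: "up_complement n c" and w: "\<And>k. k < rank_diff (Suc n) \<Longrightarrow> w k \<in> V n"
  shows "up_complement n (\<lambda>k. c k - U (w k))"
proof -
  let ?U = "U ` V n" and ?K = "{..<rank_diff (Suc n)}" and ?c = "\<lambda>k. c k - U (w k)"
  have "?c k \<in> fun_module.span (?U \<union> c ` ?K)" "c k \<in> fun_module.span (?U \<union> ?c ` ?K)" if "k \<in> ?K" for k
  proof -
    have U_w: "U (w k) \<in> ?U" using w that by simp
    then show "?c k \<in> fun_module.span (?U \<union> c ` ?K)"
      using that by (intro fun_module.span_diff fun_module.span_base) auto
    have "?c k + U (w k) \<in> fun_module.span (?U \<union> ?c ` ?K)"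
      using that U_w by (intro fun_module.span_add fun_module.span_base) auto
    then show "c k \<in> fun_module.span (?U \<union> ?c ` ?K)" by simp
  qed
  then have "fun_module.span (?U \<union> ?c ` ?K) = fun_module.span (?U \<union> c ` ?K)"
    unfolding fun_module.span_eq by (auto intro: fun_module.span_base)
  then show ?thesis using c by (simp add: up_complement_def)
qed

lemma up_complementI:
  assumes "fun_module.span (A \<union> c ` {..<rank_diff (Suc n)}) = V (Suc n)"
    and "A \<subseteq> U ` V n"
  shows "up_complement n c"
  unfolding up_complement_def
proof (rule fun_module.span_subspace)
  have "c ` {..<rank_diff (Suc n)} \<subseteq> V (Suc n)"
    unfolding assms(1)[symmetric] by (auto intro: fun_module.span_base)
  then show "U ` V n \<union> c ` {..<rank_diff (Suc n)} \<subseteq> V (Suc n)"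
    using up_in by auto
  show "V (Suc n) \<subseteq> fun_module.span (U ` V n \<union> c ` {..<rank_diff (Suc n)})"
    unfolding assms(1)[symmetric] using assms(2) by (intro fun_module.span_mono) auto
qed (rule subspace_free_module)

lemma ex_up_left_inverse_forms:
  obtains \<phi> :: "'a \<Rightarrow> ('a \<Rightarrow> int) \<Rightarrow> int"
    where "\<And>y. linear_form (\<phi> y)" "\<And>y f. y \<in> P n \<Longrightarrow> \<phi> y (U f) = f y"
proof -
  have "\<exists>g :: 'a \<Rightarrow> int. D g = indicator {y}" if "y \<in> P n" for y
    using ex_down_preimage[OF indicator_in_free_module[OF that]] by blast
  then obtain g :: "'a \<Rightarrow> 'a \<Rightarrow> int" where g: "\<And>y. y \<in> P n \<Longrightarrow> D (g y) = indicator {y}"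
    by metis
  define \<phi> where "\<phi> y v = (\<Sum>x\<in>P (Suc n). v x * g y x)" for y v
  show ?thesis
  proof (rule that[of \<phi>])
    show "linear_form (\<phi> y)" for y
      by (rule linear_formI) (simp_all add: \<phi>_def sum.distrib sum_distrib_left algebra_simps)
    fix y and f :: "'a \<Rightarrow> int"
    assume y: "y \<in> P n"
    have "\<phi> y (U f) = (\<Sum>z\<in>P n. if z = y then f z else 0)"
      unfolding \<phi>_def up_down_adjoint g[OF y] by (intro sum.cong) (auto simp: indicator_def)
    then show "\<phi> y (U f) = f y"
      using y finite_rank_set by simp
  qed
qed

lemma ex_up_complement: "\<exists>c. up_complement n c"
proof -
  let ?p = "card (P n)" and ?q = "card (P (Suc n))" and ?V = "V (Suc n) :: ('a \<Rightarrow> int) set"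
  obtain x where x: "bij_betw x {..<?p} (P n)"
    using ex_bij_betw_nat_finite[OF finite_rank_set] by (auto simp: lessThan_atLeast0)
  obtain z where z: "bij_betw z {..<?q} (P (Suc n))"
    using ex_bij_betw_nat_finite[OF finite_rank_set] by (auto simp: lessThan_atLeast0)
  have x_in: "x j \<in> P n" if "j < ?p" for j
    using x that by (auto simp: bij_betw_def)
  obtain \<phi> :: "'a \<Rightarrow> ('a \<Rightarrow> int) \<Rightarrow> int"
    where \<phi>: "\<And>y. linear_form (\<phi> y)" "\<And>y f. y \<in> P n \<Longrightarrow> \<phi> y (U f) = f y"
    by (rule ex_up_left_inverse_forms[of n]) (rule that)
  define u :: "nat \<Rightarrow> 'a \<Rightarrow> int" where "u j = U (indicator {x j})" for j
  have u_in: "u j \<in> U ` V n" if "j < ?p" for j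
    unfolding u_def using x_in[OF that] by (intro imageI indicator_in_free_module)
  have "(\<lambda>k. indicator {z k} :: 'a \<Rightarrow> int) ` {..<?q} = (\<lambda>x. indicator {x}) ` z ` {..<?q}"
    by (simp add: image_image)
  also have "z ` {..<?q} = P (Suc n)"
    using z by (rule bij_betw_imp_surj_on)
  finally have span_z: "fun_module.span ((\<lambda>k. indicator {z k}) ` {..<?q}) = ?V"
    by (simp add: span_indicator finite_rank_set)
  have "\<exists>c. fun_module.span (u ` {..<?p} \<union> c ` {..<?q - ?p})
      = fun_module.span ((\<lambda>k. indicator {z k}) ` {..<?q})"
  proof (rule int_fun_module.ex_span_complement[where \<phi> = "\<lambda>j. \<phi> (x j)"])
    show "\<phi> (x j) (u i) = of_bool (j = i)" if "i < ?p" "j < ?p" for i j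
      using that x_in \<phi>(2) inj_on_eq_iff[OF bij_betw_imp_inj_on[OF x], of i j]
      by (auto simp: u_def indicator_def)
    show "u j \<in> fun_module.span ((\<lambda>k. indicator {z k}) ` {..<?q})" if "j < ?p" for j
      unfolding span_z by (rule subsetD[OF image_subsetI[OF up_in] u_in[OF that]])
  qed (simp_all add: \<phi>(1) card_rank_set)
  then obtain c where "fun_module.span (u ` {..<?p} \<union> c ` {..<rank_diff (Suc n)}) = ?V"
    unfolding span_z by (auto simp: card_rank_set)
  moreover have "u ` {..<?p} \<subseteq> U ` V n"
    using u_in by auto
  ultimately show ?thesis
    using up_complementI by blast
qed

definition lift :: "(nat \<Rightarrow> nat \<Rightarrow> 'a \<Rightarrow> int) \<Rightarrow> nat \<Rightarrow> nat \<times> nat \<Rightarrow> 'a \<Rightarrow> int" where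
  "lift b n = (\<lambda>(i, j). (U ^^ (n - i)) (b i j))"

definition adapted :: "(nat \<Rightarrow> nat \<Rightarrow> 'a \<Rightarrow> int) \<Rightarrow> nat \<Rightarrow> bool" where
  "adapted b n \<longleftrightarrow>
     (\<forall>i\<le>n. \<forall>j<rank_diff i. b i j \<in> V i) \<and>
     (\<forall>i\<le>n. \<forall>j<rank_diff i. D (b i j) = (if 0 < i \<and> j < rank_diff (i - 1) then b (i - 1) j else 0)) \<and>
     V n \<subseteq> fun_module.span (lift b n ` chain_index rank_diff n)"

lemma adapted_in: "adapted b n \<Longrightarrow> i \<le> n \<Longrightarrow> j < rank_diff i \<Longrightarrow> b i j \<in> V i"
  unfolding adapted_def by blast

lemma adapted_down:
  "adapted b n \<Longrightarrow> i \<le> n \<Longrightarrow> j < rank_diff i \<Longrightarrow>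
    D (b i j) = (if 0 < i \<and> j < rank_diff (i - 1) then b (i - 1) j else 0)"
  unfolding adapted_def by blast

lemma adapted_span: "adapted b n \<Longrightarrow> V n \<subseteq> fun_module.span (lift b n ` chain_index rank_diff n)"
  by (simp add: adapted_def)

lemma lift_in:
  assumes "adapted b n" "k \<in> chain_index rank_diff n"
  shows "lift b n k \<in> V n"
proof (cases k)
  case (Pair i j)
  then show ?thesis
    using up_funpow_in[OF adapted_in[OF assms(1)], of i j "n - i"] assms(2) by (simp add: lift_def)
qed

lemma down_up_lift:
  assumes b: "adapted b n" and ij: "i \<le> n" "j < rank_diff i"
  shows "D (U (lift b n (i, j))) = of_nat ((n - i + 1) * r) *\<^sub>f lift b n (i, j)
    + (if 0 < i \<and> j < rank_diff (i - 1) then lift b n (i - 1, j) else 0)"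
proof -
  have "D ((U ^^ Suc (n - i)) (b i j))
      = (U ^^ Suc (n - i)) (D (b i j)) + of_nat (Suc (n - i) * r) *\<^sub>f (U ^^ (n - i)) (b i j)"
    using adapted_in[OF assms] free_module_rank_subset by (intro down_up_funpow) blast
  moreover have "n - (i - 1) = Suc (n - i)" if "0 < i"
    using that ij by simp
  ultimately show ?thesis
    unfolding lift_def adapted_down[OF assms]
    by (auto simp: up_funpow_0 add.commute simp del: funpow.simps) (simp_all add: algebra_simps)
qed

lemma adapted_jordan_chains:
  fixes c :: "'r :: comm_ring_1"
  assumes b: "adapted b n"
  shows "jordan_chains (P n) (\<lambda>f. D (U f) + c *\<^sub>f f) (\<lambda>k x. of_int (lift b n k x))
    (\<lambda>i. of_nat ((n - i + 1) * r) + c) rank_diff n"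
proof (rule jordan_chains.intro)
  show "finite (P n)" by (rule finite_rank_set)
  show "card (P n) = sum rank_diff {..n}" by (rule card_rank_set)
  show "mono rank_diff" by (rule mono_rank_diff)
  show "linear_map (\<lambda>f. D (U f) + c *\<^sub>f f)"
    by (rule linear_mapI) (simp_all add: U.add D.add U.scale D.scale algebra_simps)
  show "(\<lambda>x. of_int (lift b n k x)) \<in> V n" if "k \<in> chain_index rank_diff n" for k
    using lift_in[OF b that] by (simp add: free_module_def)
  show "V n \<subseteq> fun_module.span ((\<lambda>k x. of_int (lift b n k x) :: 'r) ` chain_index rank_diff n)"
    using finite_rank_set finite_chain_index adapted_span[OF b] by (rule free_module_subset_span_of_int)
  fix i j assume "i \<le> n" "j < rank_diff i"
  then show "D (U (\<lambda>x. of_int (lift b n (i, j) x))) + c *\<^sub>f (\<lambda>x. of_int (lift b n (i, j) x))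
      = (of_nat ((n - i + 1) * r) + c) *\<^sub>f (\<lambda>x. of_int (lift b n (i, j) x))
        + (if 0 < i \<and> j < rank_diff (i - 1) then \<lambda>x. of_int (lift b n (i - 1, j) x) else 0)"
    unfolding up_of_int down_of_int down_up_lift[OF b \<open>i \<le> n\<close> \<open>j < rank_diff i\<close>]
    by (auto simp: fun_eq_iff algebra_simps)
qed

definition cokernel_forms :: "nat \<Rightarrow> (nat \<Rightarrow> 'a \<Rightarrow> int) \<Rightarrow> (nat \<Rightarrow> ('a \<Rightarrow> int) \<Rightarrow> int) \<Rightarrow> (nat \<Rightarrow> int) \<Rightarrow> bool" where
  "cokernel_forms m t \<phi> y \<longleftrightarrow> (\<forall>j. linear_form (\<phi> j)) \<and>
     (\<forall>i<rank_diff m. \<forall>j<rank_diff m. \<phi> j (t i) = of_bool (j = i)) \<and>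
     (\<forall>v\<in>V m. (\<exists>u\<in>V m. v = D (U u)) \<longleftrightarrow> (\<forall>j<rank_diff m. y j dvd \<phi> j v))"

lemma adapted_cokernel_forms:
  assumes b: "adapted b m"
  obtains \<phi> y where "cokernel_forms m (b m) \<phi> y"
    "\<And>i j. i \<le> j \<Longrightarrow> j < rank_diff m \<Longrightarrow> y j dvd y i"
    "rank_diff m = rank_diff (Suc m) \<Longrightarrow> units_lift_mod (y (rank_diff m - 1))"
proof -
  interpret DU: jordan_chains "P m" "\<lambda>f. D (U f)" "lift b m" "\<lambda>i. int ((m - i + 1) * r)" rank_diff m
    using adapted_jordan_chains[OF b, of "0 :: int"] by simp
  have lift_m: "lift b m (m, i) = b m i" for i
    by (simp add: lift_def)
  obtain \<phi> where "\<And>j. linear_form (\<phi> j)"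
    "\<And>i j. i < rank_diff m \<Longrightarrow> j < rank_diff m \<Longrightarrow> \<phi> j (b m i) = of_bool (j = i)"
    "\<And>v. v \<in> V m \<Longrightarrow>
      v \<in> (\<lambda>f. D (U f)) ` V m \<longleftrightarrow> (\<forall>j<rank_diff m. DU.modulus j dvd \<phi> j v)"
    using DU.ex_cokernel_forms unfolding lift_m by blast
  then have "cokernel_forms m (b m) \<phi> DU.modulus"
    by (simp add: cokernel_forms_def image_iff)
  moreover have "units_lift_mod (DU.modulus (rank_diff m - 1))" if "rank_diff m = rank_diff (Suc m)"
  proof -
    have "m = 0" "r = 2" "rank_diff m = 1"
      using rank_diff_growth[of m] that by (auto simp: rank_diff_def)
    then show ?thesis
      unfolding DU.modulus_def DU.factor_def DU.chain_start_def
      using units_lift_mod_2 by (simp add: rank_diff_def)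
  qed
  ultimately show ?thesis
    using DU.modulus_dvd by (intro that)
qed

lemma ex_dual_up_complement:
  assumes forms: "cokernel_forms m t \<phi> y" and t: "\<And>i. i < rank_diff m \<Longrightarrow> t i \<in> V m"
    and y: "\<And>i j. i \<le> j \<Longrightarrow> j < rank_diff m \<Longrightarrow> y j dvd y i"
      "rank_diff m = rank_diff (Suc m) \<Longrightarrow> units_lift_mod (y (rank_diff m - 1))"
  shows "\<exists>c. up_complement m c \<and>
    int_fun_module.dual_mod (\<lambda>j v. \<phi> j (D v)) y (rank_diff m) (rank_diff (Suc m)) c"
proof -
  have \<phi>: "linear_form (\<phi> j)" for j
    using forms by (simp add: cokernel_forms_def)
  obtain c where c: "up_complement m c"
    using ex_up_complement by blast
  have "\<exists>c'. fun_module.span (c' ` {..<rank_diff (Suc m)}) = fun_module.span (c ` {..<rank_diff (Suc m)}) \<and>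
      int_fun_module.dual_mod (\<lambda>j v. \<phi> j (D v)) y (rank_diff m) (rank_diff (Suc m)) c'"
  proof (rule int_fun_module.ex_span_dual_mod)
    show "linear_form (\<lambda>v. \<phi> j (D v))" for j
      using module_hom_compose[OF linear_map_down \<phi>] by (simp add: comp_def)
    show "rank_diff m \<le> rank_diff (Suc m)"
      using mono_rank_diff by (simp add: monoD)
    fix i assume i: "i < rank_diff m"
    obtain v where v: "v \<in> V (Suc m)" "D v = t i"
      using ex_down_preimage t[OF i] by blast
    obtain u w where u: "u \<in> V m"
      and w: "w \<in> fun_module.span (c ` {..<rank_diff (Suc m)})" "v = U u + w"
      using up_complement_decompose[OF c v(1)] .
    have "y j dvd \<phi> j (D w) - of_bool (j = i)" if j: "j < rank_diff m" for j
    proof -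
      interpret \<phi>: Modules.module_hom scale_fun "(*)" "\<phi> j" by (rule \<phi>)
      have "D w = t i - D (U u)"
        unfolding v(2)[symmetric] w(2) D.add by simp
      moreover have "\<phi> j (t i) = of_bool (j = i)" "y j dvd \<phi> j (D (U u))"
        using forms i j u down_in[OF up_in[OF u]] unfolding cokernel_forms_def by blast+
      ultimately show ?thesis by (simp add: \<phi>.diff)
    qed
    then show "\<exists>v\<in>fun_module.span (c ` {..<rank_diff (Suc m)}).
        \<forall>j<rank_diff m. y j dvd \<phi> j (D v) - of_bool (j = i)"
      using w(1) by blast
  qed (use y in auto)
  then show ?thesis
    using up_complement_cong[OF c] by blast
qed

lemma ex_up_complement_down_eq:
  assumes forms: "cokernel_forms m t \<phi> y" and t: "\<And>i. i < rank_diff m \<Longrightarrow> t i \<in> V m"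
    and c: "up_complement m c"
      "int_fun_module.dual_mod (\<lambda>j v. \<phi> j (D v)) y (rank_diff m) (rank_diff (Suc m)) c"
  shows "\<exists>c. up_complement m c \<and> (\<forall>k<rank_diff (Suc m). D (c k) = (if k < rank_diff m then t k else 0))"
proof -
  define t' where "t' k = (if k < rank_diff m then t k else 0)" for k
  have "\<exists>w\<in>V m. D (c k) - t' k = D (U w)" if k: "k < rank_diff (Suc m)" for k
  proof -
    have "t' k \<in> V m"
      using t by (simp add: t'_def fun_module.subspace_0 subspace_free_module)
    then have "D (c k) - t' k \<in> V m"
      by (intro fun_module.subspace_diff subspace_free_module down_in up_complement_in[OF c(1) k])
    moreover have "y j dvd \<phi> j (D (c k) - t' k)" if j: "j < rank_diff m" for j
    proof -
      interpret \<phi>: Modules.module_hom scale_fun "(*)" "\<phi> j"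
        using forms by (simp add: cokernel_forms_def)
      have "\<phi> j (t' k) = of_bool (k = j)"
        using forms j by (auto simp: t'_def cokernel_forms_def)
      then show ?thesis
        using c(2) j k by (simp add: \<phi>.diff int_fun_module.dual_mod_def)
    qed
    ultimately show ?thesis
      using forms unfolding cokernel_forms_def by blast
  qed
  then obtain w where w: "\<And>k. k < rank_diff (Suc m) \<Longrightarrow> w k \<in> V m"
    "\<And>k. k < rank_diff (Suc m) \<Longrightarrow> D (c k) - t' k = D (U (w k))"
    by metis
  have "up_complement m (\<lambda>k. c k - U (w k))"
    using c(1) w(1) by (rule up_complement_shift)
  moreover have "D (c k - U (w k)) = t' k" if "k < rank_diff (Suc m)" for k
    unfolding D.diff w(2)[OF that, symmetric] by simp
  ultimately show ?thesis
    unfolding t'_def by blast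
qed

lemma adapted_extend:
  assumes b: "adapted b m" and c: "up_complement m c"
    and D_c: "\<And>k. k < rank_diff (Suc m) \<Longrightarrow> D (c k) = (if k < rank_diff m then b m k else 0)"
  shows "adapted (b(Suc m := c)) (Suc m)"
proof -
  let ?b = "b(Suc m := c)" and ?L = "U ` lift b m ` chain_index rank_diff m \<union> c ` {..<rank_diff (Suc m)}"
  have "chain_index rank_diff (Suc m) = chain_index rank_diff m \<union> Pair (Suc m) ` {..<rank_diff (Suc m)}"
    by (auto simp: chain_index_def le_Suc_eq)
  moreover have "lift ?b (Suc m) k = U (lift b m k)" if "k \<in> chain_index rank_diff m" for k
    using that by (cases k) (auto simp: lift_def Suc_diff_le)
  moreover have "lift ?b (Suc m) (Suc m, j) = c j" for j
    by (simp add: lift_def)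
  ultimately have L: "lift ?b (Suc m) ` chain_index rank_diff (Suc m) = ?L"
    by (simp add: image_Un image_image)
  have "U ` V m \<subseteq> U ` fun_module.span (lift b m ` chain_index rank_diff m)"
    using adapted_span[OF b] by (rule image_mono)
  also have "\<dots> \<subseteq> fun_module.span ?L"
    unfolding U.span_image[symmetric] by (intro fun_module.span_mono) simp
  finally have "U ` V m \<union> c ` {..<rank_diff (Suc m)} \<subseteq> fun_module.span ?L"
    by (auto intro: fun_module.span_base)
  then have "V (Suc m) \<subseteq> fun_module.span ?L"
    using c unfolding up_complement_def by (metis fun_module.span_minimal fun_module.subspace_span)
  then show ?thesis
    using adapted_in[OF b] adapted_down[OF b] up_complement_in[OF c] D_c
    by (auto simp: adapted_def le_Suc_eq L)
qed

lemma ex_adapted: "\<exists>b. adapted b n"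
proof (induction n)
  case 0
  obtain m where m: "P 0 = {m}" using ex_rank_set_0 ..
  define b :: "nat \<Rightarrow> nat \<Rightarrow> 'a \<Rightarrow> int" where "b i j = indicator {m}" for i j
  have K: "chain_index rank_diff 0 = {(0, 0)}"
    by (auto simp: chain_index_def rank_diff_def)
  have "b 0 0 \<in> V 0"
    unfolding b_def m by (intro indicator_in_free_module) simp
  moreover have "V 0 \<subseteq> fun_module.span (lift b 0 ` chain_index rank_diff 0)"
    unfolding m K by (intro free_module_subset_span) (auto simp: lift_def b_def intro: fun_module.span_base)
  ultimately have "adapted b 0"
    using down_eq_0[of "b 0 0"] by (auto simp: adapted_def rank_diff_def)
  then show ?case by blast
next
  case (Suc n)
  then obtain b where b: "adapted b n" by blast
  obtain \<phi> y where forms: "cokernel_forms n (b n) \<phi> y"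
    and y: "\<And>i j. i \<le> j \<Longrightarrow> j < rank_diff n \<Longrightarrow> y j dvd y i"
      "rank_diff n = rank_diff (Suc n) \<Longrightarrow> units_lift_mod (y (rank_diff n - 1))"
    using adapted_cokernel_forms[OF b] by blast
  note b_in = adapted_in[OF b order_refl]
  obtain c where "up_complement n c"
    "int_fun_module.dual_mod (\<lambda>j v. \<phi> j (D v)) y (rank_diff n) (rank_diff (Suc n)) c"
    using ex_dual_up_complement[OF forms b_in y] by blast
  then obtain c' where "up_complement n c'"
    "\<And>k. k < rank_diff (Suc n) \<Longrightarrow> D (c' k) = (if k < rank_diff n then b n k else 0)"
    using ex_up_complement_down_eq[OF forms b_in] by blast
  then show ?case
    using adapted_extend[OF b] by blast
qed

lemma matrix_of_DU_plus_xI: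
  assumes "distinct es" "set es \<subseteq> S"
  shows "matrix_of_map (\<lambda>f. D (U f) + [:0, 1:] *\<^sub>f f) es = DU_plus_xI S leq es"
proof (rule eq_matI)
  fix i j assume ij: "i < dim_row (DU_plus_xI S leq es)" "j < dim_col (DU_plus_xI S leq es)"
  then have "es ! i \<in> S" "es ! j \<in> S" "es ! i = es ! j \<longleftrightarrow> i = j"
    using assms by (auto simp: DU_plus_xI_def nth_eq_iff_index_eq subset_iff)
  then show "matrix_of_map (\<lambda>f. D (U f) + [:0, 1:] *\<^sub>f f) es $$ (i, j) = DU_plus_xI S leq es $$ (i, j)"
    using ij by (simp add: matrix_of_map_def family_mat_def DU_plus_xI_def down_up_indicator
        indicator_def conj_commute)
qed (simp_all add: matrix_of_map_def family_mat_def DU_plus_xI_def)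

theorem has_smith_normal_form_DU_plus_xI:
  assumes "distinct es" "set es = P n"
  shows "has_smith_normal_form (DU_plus_xI S leq es)"
proof -
  obtain b where "adapted b n" using ex_adapted by blast
  then interpret DU: jordan_chains "P n" "\<lambda>f. D (U f) + [:0, 1:] *\<^sub>f f" "\<lambda>k x. of_int (lift b n k x)"
    "\<lambda>i. of_nat ((n - i + 1) * r) + [:0, 1 :: int:]" rank_diff n
    by (rule adapted_jordan_chains)
  have "set es \<subseteq> S" using assms(2) by (auto simp: in_rank_set_iff)
  then show ?thesis
    using DU.has_smith_normal_form[OF assms] matrix_of_DU_plus_xI assms(1) by simp
qed

end

section \<open>Products of differential posets\<close>

lemma down_cong: "(\<And>y. y \<in> S \<Longrightarrow> f y = g y) \<Longrightarrow> down S leq f x = down S leq g x"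
  by (auto simp: down_def covby_def intro!: sum.cong)

lemma up_cong: "(\<And>y. y \<in> S \<Longrightarrow> f y = g y) \<Longrightarrow> up S leq f x = up S leq g x"
  by (auto simp: up_def covby_def intro!: sum.cong)

lemma down_up_swap:
  "down S le1 (\<lambda>a. up T le2 (f a) y) x = up T le2 (\<lambda>b. down S le1 (\<lambda>a. f a b) x) y"
  unfolding down_def up_def by (rule sum.swap)

locale poset_product =
  P: locally_finite_poset S le1 + Q: locally_finite_poset T le2
  for S :: "'a set" and le1 and T :: "'b set" and le2
begin

abbreviation "leq \<equiv> prod_le le1 le2"

lemma covby_prod_fst: "covby S le1 x x' \<Longrightarrow> y \<in> T \<Longrightarrow> covby (S \<times> T) leq (x, y) (x', y)"
  using Q.antisym Q.refl by (auto simp: covby_def prod_le_def)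

lemma covby_prod_snd: "covby T le2 y y' \<Longrightarrow> x \<in> S \<Longrightarrow> covby (S \<times> T) leq (x, y) (x, y')"
  using P.antisym P.refl by (auto simp: covby_def prod_le_def)

lemma covby_prodD:
  assumes "covby (S \<times> T) leq (x, y) (x', y')"
  shows "covby S le1 x x' \<and> y = y' \<or> x = x' \<and> covby T le2 y y'"
proof -
  have mem: "x \<in> S" "x' \<in> S" "y \<in> T" "y' \<in> T" and le: "le1 x x'" "le2 y y'" and ne: "(x, y) \<noteq> (x', y')"
    and between: "\<And>a b. a \<in> S \<Longrightarrow> b \<in> T \<Longrightarrow> le1 x a \<Longrightarrow> le2 y b \<Longrightarrow> le1 a x' \<Longrightarrow> le2 b y' \<Longrightarrow>
      (a, b) = (x, y) \<or> (a, b) = (x', y')"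
    using assms unfolding covby_def prod_le_def by auto
  have "(x', y) = (x, y) \<or> (x', y) = (x', y')"
    using mem le P.refl Q.refl by (intro between) auto
  then consider "x = x'" "y \<noteq> y'" | "y = y'" "x \<noteq> x'" using ne by auto
  then show ?thesis
  proof cases
    case 1
    then show ?thesis
      using between[of x] mem le P.refl by (auto simp: covby_def)
  next
    case 2
    then show ?thesis
      using between[of _ y] mem le Q.refl by (auto simp: covby_def)
  qed
qed

lemma covby_prod_iff:
  assumes "x \<in> S" "y \<in> T"
  shows "covby (S \<times> T) leq (x, y) (x', y') \<longleftrightarrow> covby S le1 x x' \<and> y = y' \<or> x = x' \<and> covby T le2 y y'"
    and "covby (S \<times> T) leq (x', y') (x, y) \<longleftrightarrow> covby S le1 x' x \<and> y = y' \<or> x = x' \<and> covby T le2 y' y"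
  using assms covby_prodD covby_prod_fst covby_prod_snd by blast+

sublocale prod: locally_finite_poset "S \<times> T" leq
proof
  show "partial_order_on' (S \<times> T) leq"
    unfolding partial_order_on'_def prod_le_def
  proof (intro conjI ballI impI)
    fix u v w assume "u \<in> S \<times> T" "v \<in> S \<times> T" "w \<in> S \<times> T"
    then have mem: "fst u \<in> S" "fst v \<in> S" "fst w \<in> S" "snd u \<in> T" "snd v \<in> T" "snd w \<in> T"
      by auto
    show "le1 (fst u) (fst u)" "le2 (snd u) (snd u)"
      using mem P.refl Q.refl by auto
    show "u = v"
      if "(le1 (fst u) (fst v) \<and> le2 (snd u) (snd v)) \<and> le1 (fst v) (fst u) \<and> le2 (snd v) (snd u)"
      using that mem P.antisym Q.antisym by (simp add: prod_eq_iff)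
    assume "(le1 (fst u) (fst v) \<and> le2 (snd u) (snd v)) \<and> le1 (fst v) (fst w) \<and> le2 (snd v) (snd w)"
    then show "le1 (fst u) (fst w)" "le2 (snd u) (snd w)"
      using mem P.trans[of "fst u" "fst v" "fst w"] Q.trans[of "snd u" "snd v" "snd w"] by auto
  qed
  show "locally_finite (S \<times> T) leq"
    unfolding locally_finite_def
  proof (intro ballI)
    fix u v assume "u \<in> S \<times> T" "v \<in> S \<times> T"
    then have "finite ({z \<in> S. le1 (fst u) z \<and> le1 z (fst v)} \<times> {z \<in> T. le2 (snd u) z \<and> le2 z (snd v)})"
      using P.locally_finite Q.locally_finite unfolding locally_finite_def by auto
    then show "finite {z \<in> S \<times> T. leq u z \<and> leq z v}"
      by (rule rev_finite_subset) (auto simp: prod_le_def)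
  qed
qed

lemma is_rank_fun_prod:
  assumes rk1: "is_rank_fun S le1 rk1" and rk2: "is_rank_fun T le2 rk2"
  shows "is_rank_fun (S \<times> T) leq (\<lambda>(x, y). rk1 x + rk2 y)"
  unfolding is_rank_fun_def
proof (intro conjI ballI allI impI)
  fix u assume "u \<in> S \<times> T" and min: "\<forall>v\<in>S \<times> T. leq v u \<longrightarrow> v = u"
  then obtain x y where u: "u = (x, y)" "x \<in> S" "y \<in> T" by auto
  then have "\<forall>a\<in>S. le1 a x \<longrightarrow> a = x" "\<forall>b\<in>T. le2 b y \<longrightarrow> b = y"
    using min P.refl Q.refl by (auto simp: prod_le_def)
  then show "(case u of (x, y) \<Rightarrow> rk1 x + rk2 y) = 0"
    using rk1 rk2 u by (simp add: is_rank_fun_def)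
next
  fix u v assume "covby (S \<times> T) leq u v"
  then show "(case v of (x, y) \<Rightarrow> rk1 x + rk2 y) = (case u of (x, y) \<Rightarrow> rk1 x + rk2 y) + 1"
    using covby_prodD rk1 rk2 by (cases u; cases v) (fastforce simp: is_rank_fun_def)
qed

end

locale graded_poset_product =
  P: graded_poset S le1 + Q: graded_poset T le2
  for S :: "'a set" and le1 and T :: "'b set" and le2
begin

sublocale poset_product S le1 T le2 ..

lemma rank_prod:
  assumes "x \<in> S" "y \<in> T"
  shows "rank_of (S \<times> T) leq (x, y) = P.rank x + Q.rank y"
proof -
  have sum: "is_rank_fun (S \<times> T) leq (\<lambda>(x, y). P.rank x + Q.rank y)"
    by (rule is_rank_fun_prod[OF P.rank_fun Q.rank_fun])
  then have "is_rank_fun (S \<times> T) leq (rank_of (S \<times> T) leq)"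
    unfolding rank_of_def[of "S \<times> T"] by (rule someI[of "is_rank_fun (S \<times> T) leq"])
  then show ?thesis
    using prod.rank_fun_unique[OF _ sum, of _ "(x, y)"] assms by simp
qed

lemma rank_set_prod: "rank_set (S \<times> T) leq n = (\<Union>i\<le>n. rank_set S le1 i \<times> rank_set T le2 (n - i))"
  by (force simp: rank_set_def rank_prod)

lemma rank_size_prod: "rank_size (S \<times> T) leq n = (\<Sum>i\<le>n. rank_size S le1 i * rank_size T le2 (n - i))"
  unfolding rank_size_def rank_set_prod card_cartesian_product[symmetric]
proof (rule card_UN_disjoint)
  show "\<forall>i\<in>{..n}. finite (rank_set S le1 i \<times> rank_set T le2 (n - i))"
    using P.finite_rank_set Q.finite_rank_set by blast
qed (auto simp: rank_set_def)

sublocale prod: graded_poset "S \<times> T" leq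
proof
  show "graded (S \<times> T) leq"
    unfolding graded_def using is_rank_fun_prod[OF P.rank_fun Q.rank_fun] by blast
  show "finite (rank_set (S \<times> T) leq n)" for n
    unfolding rank_set_prod using P.finite_rank_set Q.finite_rank_set by blast
  show "has_unique_min (S \<times> T) leq"
    using P.unique_min Q.unique_min unfolding has_unique_min_def prod_le_def by fastforce
qed

lemma up_prod:
  assumes "x \<in> S" "y \<in> T"
  shows "prod.U f (x, y) = P.U (\<lambda>a. f (a, y)) x + Q.U (\<lambda>b. f (x, b)) y"
proof -
  have "{p. covby (S \<times> T) leq p (x, y)}
      = (\<lambda>a. (a, y)) ` {a. covby S le1 a x} \<union> Pair x ` {b. covby T le2 b y}"
    using covby_prod_iff(2)[OF assms] by auto
  moreover have "(\<lambda>a. (a, y)) ` {a. covby S le1 a x} \<inter> Pair x ` {b. covby T le2 b y} = {}"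
    by (auto simp: covby_def)
  ultimately show ?thesis
    by (simp add: up_def sum.union_disjoint P.finite_covers_below Q.finite_covers_below
        sum.reindex inj_on_def)
qed

lemma down_prod:
  assumes "x \<in> S" "y \<in> T"
  shows "prod.D f (x, y) = P.D (\<lambda>a. f (a, y)) x + Q.D (\<lambda>b. f (x, b)) y"
proof -
  have "{p. covby (S \<times> T) leq (x, y) p}
      = (\<lambda>a. (a, y)) ` {a. covby S le1 x a} \<union> Pair x ` {b. covby T le2 y b}"
    using covby_prod_iff(1)[OF assms] by auto
  moreover have "(\<lambda>a. (a, y)) ` {a. covby S le1 x a} \<inter> Pair x ` {b. covby T le2 y b} = {}"
    by (auto simp: covby_def)
  ultimately show ?thesis
    by (simp add: down_def sum.union_disjoint P.finite_covers_above Q.finite_covers_above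
        sum.reindex inj_on_def)
qed

lemma down_up_prod:
  fixes f :: "'a \<times> 'b \<Rightarrow> 'r :: comm_ring_1"
  assumes "x \<in> S" "y \<in> T"
  shows "prod.D (prod.U f) (x, y) = P.D (P.U (\<lambda>a. f (a, y))) x + Q.D (Q.U (\<lambda>b. f (x, b))) y
    + P.D (\<lambda>a. Q.U (\<lambda>b. f (a, b)) y) x + Q.D (\<lambda>b. P.U (\<lambda>a. f (a, b)) x) y"
proof -
  have "P.D (\<lambda>a. prod.U f (a, y)) x = P.D (P.U (\<lambda>a. f (a, y)) + (\<lambda>a. Q.U (\<lambda>b. f (a, b)) y)) x"
    by (rule down_cong) (simp add: up_prod assms)
  moreover have "Q.D (\<lambda>b. prod.U f (x, b)) y = Q.D ((\<lambda>b. P.U (\<lambda>a. f (a, b)) x) + Q.U (\<lambda>b. f (x, b))) y"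
    by (rule down_cong) (simp add: up_prod assms)
  ultimately show ?thesis
    by (simp add: down_prod assms P.D.add Q.D.add)
qed

lemma up_down_prod:
  fixes f :: "'a \<times> 'b \<Rightarrow> 'r :: comm_ring_1"
  assumes "x \<in> S" "y \<in> T"
  shows "prod.U (prod.D f) (x, y) = P.U (P.D (\<lambda>a. f (a, y))) x + Q.U (Q.D (\<lambda>b. f (x, b))) y
    + Q.U (\<lambda>b. P.D (\<lambda>a. f (a, b)) x) y + P.U (\<lambda>a. Q.D (\<lambda>b. f (a, b)) y) x"
proof -
  have "P.U (\<lambda>a. prod.D f (a, y)) x = P.U (P.D (\<lambda>a. f (a, y)) + (\<lambda>a. Q.D (\<lambda>b. f (a, b)) y)) x"
    by (rule up_cong) (simp add: down_prod assms)
  moreover have "Q.U (\<lambda>b. prod.D f (x, b)) y = Q.U ((\<lambda>b. P.D (\<lambda>a. f (a, b)) x) + Q.D (\<lambda>b. f (x, b))) y"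
    by (rule up_cong) (simp add: down_prod assms)
  ultimately show ?thesis
    by (simp add: up_prod assms P.U.add Q.U.add)
qed

lemma differential_prod:
  assumes P: "differential S le1 r" and Q: "differential T le2 s"
  shows "differential (S \<times> T) leq (r + s)"
proof (rule prod.differentialI_commutator)
  show "0 < r + s" using P by (simp add: differential_def)
  fix f :: "'a \<times> 'b \<Rightarrow> int" and u assume "u \<in> S \<times> T"
  then obtain x y where u: "u = (x, y)" "x \<in> S" "y \<in> T" by auto
  have "P.D (\<lambda>a. Q.U (\<lambda>b. f (a, b)) y) x = Q.U (\<lambda>b. P.D (\<lambda>a. f (a, b)) x) y"
    "Q.D (\<lambda>b. P.U (\<lambda>a. f (a, b)) x) y = P.U (\<lambda>a. Q.D (\<lambda>b. f (a, b)) y) x"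
    by (rule down_up_swap)+
  then show "prod.D (prod.U f) u = prod.U (prod.D f) u + int (r + s) * f u"
    using u by (simp add: down_up_prod up_down_prod P.down_up_commutator[OF P]
        Q.down_up_commutator[OF Q] algebra_simps)
qed

end

context graded_poset
begin

text \<open>The function \<open>f\<close> is chosen rank by rank: its values on rank \<open>i\<close> determine those on rank \<open>i + 1\<close>.\<close>

lemma ex_down_plus_preimage:
  fixes E :: "('b \<Rightarrow> int) \<Rightarrow> 'b \<Rightarrow> int"
  assumes "down_maps_surjective S leq"
  shows "\<exists>f. \<forall>x\<in>S. \<forall>y. D (\<lambda>a. f a y) x + E (f x) y = g x y"
proof -
  have "\<forall>h :: 'a \<Rightarrow> int. \<exists>f. \<forall>x\<in>S. D f x = h x"
    using assms by (simp add: down_maps_surjective_iff)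
  then obtain \<sigma> :: "('a \<Rightarrow> int) \<Rightarrow> 'a \<Rightarrow> int" where \<sigma>: "\<And>h x. x \<in> S \<Longrightarrow> D (\<sigma> h) x = h x"
    by metis
  define F where "F = rec_nat (\<lambda>x y. 0) (\<lambda>i G x y. \<sigma> (\<lambda>x'. g x' y - E (G x') y) x)"
  have F_Suc: "F (Suc i) x y = \<sigma> (\<lambda>x'. g x' y - E (F i x') y) x" for i x y
    by (simp add: F_def)
  have "D (\<lambda>a. F (rank a) a y) x + E (F (rank x) x) y = g x y" if x: "x \<in> S" for x y
  proof -
    have "D (\<lambda>a. F (rank a) a y) x = D (\<sigma> (\<lambda>x'. g x' y - E (F (rank x) x') y)) x"
      unfolding down_def by (intro sum.cong) (auto simp: rank_covby F_Suc)
    then show ?thesis by (simp add: \<sigma>[OF x])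
  qed
  then show ?thesis by (intro exI[of _ "\<lambda>x. F (rank x) x"]) blast
qed

end

lemma (in graded_poset_product) down_maps_surjective_prod:
  assumes "down_maps_surjective S le1 \<or> down_maps_surjective T le2"
  shows "down_maps_surjective (S \<times> T) leq"
  unfolding prod.down_maps_surjective_iff
proof
  fix g :: "'a \<times> 'b \<Rightarrow> int"
  have "\<exists>f. \<forall>x\<in>S. \<forall>y\<in>T. P.D (\<lambda>a. f a y) x + Q.D (f x) y = g (x, y)"
    using assms
  proof
    assume "down_maps_surjective S le1"
    then show ?thesis
      using P.ex_down_plus_preimage[of Q.D "\<lambda>x y. g (x, y)"] by blast
  next
    assume "down_maps_surjective T le2"
    then obtain f where "\<forall>y\<in>T. \<forall>x. Q.D (\<lambda>b. f b x) y + P.D (f y) x = g (x, y)"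
      using Q.ex_down_plus_preimage[of P.D "\<lambda>y x. g (x, y)"] by blast
    then show ?thesis
      by (intro exI[of _ "\<lambda>x y. f y x"]) (simp add: add.commute)
  qed
  then obtain f where f: "\<And>x y. x \<in> S \<Longrightarrow> y \<in> T \<Longrightarrow> P.D (\<lambda>a. f a y) x + Q.D (f x) y = g (x, y)"
    by blast
  have "prod.D (\<lambda>(x, y). f x y) u = g u" if "u \<in> S \<times> T" for u
    using that f by (auto simp: down_prod)
  then show "\<exists>f. \<forall>u\<in>S \<times> T. prod.D f u = g u" by blast
qed

lemma convolution_second_difference:
  fixes p q :: "nat \<Rightarrow> 'r :: comm_ring_1"
  defines "c \<equiv> \<lambda>n. \<Sum>i\<le>n. p i * q (n - i)"
  shows "c (Suc (Suc n)) - 2 * c (Suc n) + c n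
    = (\<Sum>i\<le>n. p i * (q (Suc (Suc n) - i) - 2 * q (Suc n - i) + q (n - i)))
      + p (Suc n) * (q 1 - 2 * q 0) + p (Suc (Suc n)) * q 0"
proof -
  have "c (Suc (Suc n)) = (\<Sum>i\<le>n. p i * q (Suc (Suc n) - i)) + p (Suc n) * q 1 + p (Suc (Suc n)) * q 0"
    by (simp add: c_def)
  moreover have "c (Suc n) = (\<Sum>i\<le>n. p i * q (Suc n - i)) + p (Suc n) * q 0"
    by (simp add: c_def)
  ultimately show ?thesis
    by (simp add: c_def sum.distrib sum_subtractf sum_distrib_left algebra_simps)
qed

locale differential_product =
  P: differential_poset S le1 r + Q: differential_poset T le2 s
  for S :: "'a set" and le1 r and T :: "'b set" and le2 s
begin

sublocale graded_poset_product S le1 T le2 ..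

lemma rank_size_prod_convex:
  assumes growth: "\<And>n. int (rank_size T le2 (Suc (Suc n))) - int (rank_size T le2 (Suc n))
      \<ge> int (rank_size T le2 (Suc n)) - int (rank_size T le2 n)"
  shows "2 * rank_size (S \<times> T) leq (Suc n) < rank_size (S \<times> T) leq n + rank_size (S \<times> T) leq (Suc (Suc n))"
proof -
  let ?p = "\<lambda>i. int (rank_size S le1 i)" and ?q = "\<lambda>i. int (rank_size T le2 i)"
    and ?c = "\<lambda>k. int (rank_size (S \<times> T) leq k)"
  define \<Delta> where "\<Delta> i = ?q (Suc (Suc n) - i) - 2 * ?q (Suc n - i) + ?q (n - i)" for i
  have \<Delta>_nonneg: "0 \<le> \<Delta> i" if "i \<le> n" for i
    using growth[of "n - i"] that by (simp add: \<Delta>_def Suc_diff_le)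
  have "?c k = (\<Sum>i\<le>k. ?p i * ?q (k - i))" for k
    by (simp add: rank_size_prod)
  then have second_difference: "?c (Suc (Suc n)) - 2 * ?c (Suc n) + ?c n
      = (\<Sum>i\<le>n. ?p i * \<Delta> i) + ?p (Suc n) * (int s - 2) + ?p (Suc (Suc n))"
    unfolding \<Delta>_def using convolution_second_difference[of ?p ?q n] Q.rank_size_0 Q.rank_size_1 by simp
  have "0 < (\<Sum>i\<le>n. ?p i * \<Delta> i) + ?p (Suc n) * (int s - 2) + ?p (Suc (Suc n))"
  proof (cases "s = 1")
    case False
    then have "0 \<le> ?p (Suc n) * (int s - 2)" using Q.r_pos by simp
    moreover have "0 \<le> (\<Sum>i\<le>n. ?p i * \<Delta> i)"
      using \<Delta>_nonneg by (intro sum_nonneg) simp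
    ultimately show ?thesis using P.rank_size_pos[of "Suc (Suc n)"] by simp
  next
    case True
    have "\<Delta> n = 1"
      using Q.rank_size_0 Q.rank_size_1 Q.rank_size_2[OF True] True by (simp add: \<Delta>_def numeral_2_eq_2)
    then have "?p n \<le> (\<Sum>i\<le>n. ?p i * \<Delta> i)"
      using member_le_sum[of n "{..n}" "\<lambda>i. ?p i * \<Delta> i"] \<Delta>_nonneg by simp
    then show ?thesis
      using P.rank_size_pos[of n] P.rank_size_mono[of "Suc n"] True by simp
  qed
  then show ?thesis using second_difference by linarith
qed

end

theorem mainTheorem7:
  fixes S :: "'a set" and le1 :: "'a \<Rightarrow> 'a \<Rightarrow> bool" and r :: nat
    and T :: "'b set" and le2 :: "'b \<Rightarrow> 'b \<Rightarrow> bool" and s :: nat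
  assumes P_diff: "differential S le1 r"
    and Q_diff: "differential T le2 s"
    and Q_growth: "\<forall>n\<ge>2. int (rank_size T le2 n) - int (rank_size T le2 (n - 1))
                         \<ge> int (rank_size T le2 (n - 1)) - int (rank_size T le2 (n - 2))"
    and surj: "down_maps_surjective S le1 \<or> down_maps_surjective T le2"
  shows "\<forall>n (es :: ('a \<times> 'b) list). distinct es \<and> set es = rank_set (S \<times> T) (prod_le le1 le2) n
           \<longrightarrow> has_smith_normal_form (DU_plus_xI (S \<times> T) (prod_le le1 le2) es)"
proof -
  interpret factors: differential_product S le1 r T le2 s
    by unfold_locales (fact P_diff Q_diff)+
  interpret convex_differential_poset "S \<times> T" "prod_le le1 le2" "r + s"
  proof unfold_locales
    show "differential (S \<times> T) (prod_le le1 le2) (r + s)"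
      by (rule factors.differential_prod[OF P_diff Q_diff])
    show "down_maps_surjective (S \<times> T) (prod_le le1 le2)"
      by (rule factors.down_maps_surjective_prod[OF surj])
    show "2 \<le> r + s"
      using factors.P.r_pos factors.Q.r_pos by linarith
    show "2 * rank_size (S \<times> T) (prod_le le1 le2) (Suc n)
        < rank_size (S \<times> T) (prod_le le1 le2) n + rank_size (S \<times> T) (prod_le le1 le2) (Suc (Suc n))" for n
      using Q_growth[rule_format, of "Suc (Suc _)"] by (intro factors.rank_size_prod_convex) simp
  qed
  show ?thesis
    using has_smith_normal_form_DU_plus_xI by blast
qed

end
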